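(* Algorithm B (described in the context), run with inputs $x_{\rm in}$, $\Delta_0$, $\alpha$, target accuracy $\epsilon>0$, constants $G,\overline G_0$ and any weak proximal oracle $\mathcal A$, returns a point $\widehat x\in\mathrm{dom}(\mathcal R)$ with $F(\widehat x)-F^*\le\epsilon$ using $$ O\left(1+\frac{G^2}{\alpha\epsilon}+\log\left(1+\log\left(1+\frac{\alpha\Delta_0}{G^2}\right)\right)\right) $$ weak proximal oracle calls and $$ O\left(\frac{\overline G_0^2}{\alpha\epsilon}+\frac{\overline G_0^2}{G^2}\left(1+\log\left(1+\log\left(1+\frac{\alpha\Delta_0}{G^2}\right)\right)\right)\right) $$ subgradient calls to $f$, where the $O(\cdot)$ hide universal constants.
   Context: Setting. $\mathbb V$ is a finite-dimensional Euclidean space with inner product $\langle\cdot,\cdot\rangle$ and norm $\|\cdot\|$. $f:\mathbb V\to\mathbb R$ is closed and convex (no smoothness assumed), $\mathcal R:\mathbb V\to\mathbb R\cup\{+\infty\}$ is proper, closed and convex, $F:=f+\mathcal R$, $F^*:=\min F$, and $\mathcal X^*:=\arg\min F$ is nonempty. For some $\alpha>0$ the quadratic growth condition holds: $F(x)-F^*\ge\frac{\alpha}{2}\mathrm{dist}(x,\mathcal X^* )^2$ for all $x\in\mathrm{dom}(\mathcal R)$, where $\mathrm{dist}(x,S)=\inf_{z\in S}\|x-z\|$. Weak proximal oracle: a map $\mathcal A:\mathbb V\times\mathbb R_+\to\mathrm{dom}(\mathcal R)$ such that for every $y\in\mathbb V$ and $\lambda>0$, the output $x=\mathcal A(y,\lambda)$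 satisfies $\lambda\|x-y\|^2+\mathcal R(x)\le\lambda\|x^*-y\|^2+\mathcal R(x^* )$ for all $x^*\in\mathcal X^*$. Constants. $x_{\rm in}\in\mathrm{dom}(\mathcal R)$; $\Delta_0$ is a known bound with $F(x_{\rm in})-F^*\le\Delta_0$; $\mathcal L_0:=\{x\in\mathrm{dom}(\mathcal R):F(x)-F^*\le\Delta_0\}$; $G>0$ is such that $\|g\|\le G$ for all $x\in\mathcal L_0$, $g\in\partial f(x)$; $D_0:=\sqrt{2\Delta_0/\alpha}$; $\mathcal U_0:=\{u\in\mathbb V:\mathrm{dist}(u,\mathcal L_0)\le D_0\}$; $\overline G_0:=\max\{G,\ \sup\{\|g\|:u\in\mathcal U_0,\ g\in\partial f(u)\}\}$, assumed finite. Algorithm A (one stage). Inputs: center $c\in\mathrm{dom}(\mathcal R)$, radius $D>0$, constants $G,\overline G_0>0$, integers $T,K\ge 1$, weak proximal oracle $\mathcal A$. Set $\eta=G/(D\sqrt T)$, $\rho=(\overline G_0/D)\sqrt{T/K}$, $\mathcal Y=\{y:\|y-c\|\le D\}$, $q_1=0$, $y_{1,1}=c$. For $t=1,\dots,T$: let $v_t=\mathcal A(c-\frac{q_t}{2\eta},\eta)$; for $s=1,\dots,K$ choose any $g_{t,s}\in\partial f(y_{t,s})$ and set $$y_{t,s+1}=\Pi_{\mathcal Y}\left(\frac{\rho K y_{t,s}+q_t+\eta v_t-g_{t,s}}{\rho K+\eta}\right),$$ where $\Pi_{\mathcal Y}$ is Euclidean projection onto $\mathcal Y$; then set $\widehat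 y_t=\frac1K\sum_{s=1}^K y_{t,s+1}$, $q_{t+1}=q_t+\eta(v_t-\widehat y_t)$, $y_{t+1,1}=y_{t,K+1}$. Return $\overline v_T=\frac1T\sum_{t=1}^T v_t$. Algorithm B. Set $x\leftarrow x_{\rm in}$, $\Delta\leftarrow\Delta_0$, $K\leftarrow\lceil\overline G_0^2/G^2\rceil$. While $\Delta>\epsilon$: set $D\leftarrow\sqrt{2\Delta/\alpha}$, $T\leftarrow\lceil 288G^2/(\alpha\Delta)\rceil$; set $x\leftarrow$ output of Algorithm A with center $x$, radius $D$, constants $G,\overline G_0$, integers $T,K$ and oracle $\mathcal A$; set $\Delta\leftarrow 6G\sqrt{2\Delta/(\alpha T)}$. When the loop ends, return $x$. *)

theory Defs
  imports "HOL-Analysis.Analysis" "HOL-Library.While_Combinator"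
begin

section \<open>Extended-valued convex functions\<close>

definition effective_domain :: "('a \<Rightarrow> ereal) \<Rightarrow> 'a set" where
  "effective_domain R = {x. R x < \<infinity>}"

definition proper_fun :: "('a \<Rightarrow> ereal) \<Rightarrow> bool" where
  "proper_fun R \<longleftrightarrow> (\<forall>x. R x \<noteq> -\<infinity>) \<and> effective_domain R \<noteq> {}"

text \<open>The library's \<open>epigraph\<close> only covers real-valued functions.\<close>

definition ereal_epigraph :: "('a \<Rightarrow> ereal) \<Rightarrow> ('a \<times> real) set" where
  "ereal_epigraph R = {(x, r). R x \<le> ereal r}"

definition closed_fun :: "('a::topological_space \<Rightarrow> ereal) \<Rightarrow> bool" where
  "closed_fun R \<longleftrightarrow> closed (ereal_epigraph R)"

definition convex_fun :: "('a::real_vector \<Rightarrow> ereal) \<Rightarrow> bool" where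
  "convex_fun R \<longleftrightarrow> convex (ereal_epigraph R)"

definition subdifferential :: "('a::real_inner \<Rightarrow> real) \<Rightarrow> 'a \<Rightarrow> 'a set" where
  "subdifferential f x = {g. \<forall>z. f z \<ge> f x + g \<bullet> (z - x)}"


section \<open>The composite problem\<close>

definition objective :: "('a \<Rightarrow> real) \<Rightarrow> ('a \<Rightarrow> ereal) \<Rightarrow> 'a \<Rightarrow> ereal" where
  "objective f R x = ereal (f x) + R x"

definition optimal_value :: "('a \<Rightarrow> real) \<Rightarrow> ('a \<Rightarrow> ereal) \<Rightarrow> ereal" where
  "optimal_value f R = (INF x. objective f R x)"

definition minimizers :: "('a \<Rightarrow> real) \<Rightarrow> ('a \<Rightarrow> ereal) \<Rightarrow> 'a set" where
  "minimizers f R = {x. is_arg_min (objective f R) (\<lambda>_. True) x}"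

definition quadratic_growth ::
    "('a::metric_space \<Rightarrow> real) \<Rightarrow> ('a \<Rightarrow> ereal) \<Rightarrow> real \<Rightarrow> bool" where
  "quadratic_growth f R \<alpha> \<longleftrightarrow>
     (\<forall>x\<in>effective_domain R.
        objective f R x - optimal_value f R \<ge> ereal (\<alpha> / 2 * (infdist x (minimizers f R))\<^sup>2))"

definition sublevel :: "('a \<Rightarrow> real) \<Rightarrow> ('a \<Rightarrow> ereal) \<Rightarrow> real \<Rightarrow> 'a set" where
  "sublevel f R \<Delta> =
     {x \<in> effective_domain R. objective f R x - optimal_value f R \<le> ereal \<Delta>}"

definition enlarged_sublevel ::
    "('a::metric_space \<Rightarrow> real) \<Rightarrow> ('a \<Rightarrow> ereal) \<Rightarrow> real \<Rightarrow> real \<Rightarrow> 'a set" where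
  "enlarged_sublevel f R \<alpha> \<Delta> = {u. infdist u (sublevel f R \<Delta>) \<le> sqrt (2 * \<Delta> / \<alpha>)}"

definition weak_proximal_oracle ::
    "('a::real_inner \<Rightarrow> real) \<Rightarrow> ('a \<Rightarrow> ereal) \<Rightarrow> ('a \<Rightarrow> real \<Rightarrow> 'a) \<Rightarrow> bool" where
  "weak_proximal_oracle f R A \<longleftrightarrow>
     (\<forall>y. \<forall>l\<ge>0. A y l \<in> effective_domain R) \<and>
     (\<forall>y. \<forall>l>0. \<forall>z\<in>minimizers f R.
        ereal (l * (norm (A y l - y))\<^sup>2) + R (A y l) \<le> ereal (l * (norm (z - y))\<^sup>2) + R z)"


section \<open>The algorithms\<close>

text \<open>
  The free choice of a subgradient in each inner step is modelled by a family \<open>g\<close> indexed by the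
  running number of the query: if the query point of query number \<open>m\<close> is \<open>y\<close>, the answer is
  \<open>g m y\<close>. Quantifying over all such families with \<open>g m y \<in> subdifferential f y\<close> covers every
  sequence of choices, because a finite convex function has a subgradient everywhere; in particular the same point may receive different subgradients at
  different times. The index \<open>m\<close> is at the same time the counter of subgradient calls, and
  \<open>n\<close> counts the calls of the weak proximal oracle.
\<close>

type_synonym 'a subgrad_choice = "nat \<Rightarrow> 'a \<Rightarrow> 'a"

text \<open>State: current point \<open>y\<^sub>t\<^sub>,\<^sub>s\<close>, sum of the points computed so far in this
  inner loop (which leaves out \<open>y\<^sub>t\<^sub>,\<^sub>1\<close>), subgradient counter.\<close>

definition inner_step ::
    "'a::euclidean_space subgrad_choice \<Rightarrow> 'a \<Rightarrow> real \<Rightarrow> real \<Rightarrow> real \<Rightarrow> nat \<Rightarrow> 'a \<Rightarrow> 'a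
      \<Rightarrow> 'a \<times> 'a \<times> nat \<Rightarrow> 'a \<times> 'a \<times> nat" where
  "inner_step g c D \<eta> \<rho> K q v = (\<lambda>(y, ysum, m).
     let y' = closest_point (cball c D)
                ((1 / (\<rho> * real K + \<eta>)) *\<^sub>R ((\<rho> * real K) *\<^sub>R y + q + \<eta> *\<^sub>R v - g m y))
     in (y', ysum + y', Suc m))"

text \<open>State: \<open>q\<^sub>t\<close>, \<open>y\<^sub>t\<^sub>,\<^sub>1\<close>, sum of the oracle outputs \<open>v\<close> so far, oracle counter,
  subgradient counter.\<close>

definition outer_step ::
    "'a::euclidean_space subgrad_choice \<Rightarrow> ('a \<Rightarrow> real \<Rightarrow> 'a) \<Rightarrow> 'a \<Rightarrow> real \<Rightarrow> real \<Rightarrow> real \<Rightarrow> nat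
      \<Rightarrow> 'a \<times> 'a \<times> 'a \<times> nat \<times> nat \<Rightarrow> 'a \<times> 'a \<times> 'a \<times> nat \<times> nat" where
  "outer_step g A c D \<eta> \<rho> K = (\<lambda>(q, y, vsum, n, m).
     let v = A (c - (1 / (2 * \<eta>)) *\<^sub>R q) \<eta>;
         (y', ysum, m') = (inner_step g c D \<eta> \<rho> K q v ^^ K) (y, 0, m);
         yhat = (1 / real K) *\<^sub>R ysum
     in (q + \<eta> *\<^sub>R (v - yhat), y', vsum + v, Suc n, m'))"

definition algorithm_A ::
    "'a::euclidean_space subgrad_choice \<Rightarrow> ('a \<Rightarrow> real \<Rightarrow> 'a) \<Rightarrow> 'a \<Rightarrow> real \<Rightarrow> real \<Rightarrow> real
      \<Rightarrow> nat \<Rightarrow> nat \<Rightarrow> nat \<Rightarrow> nat \<Rightarrow> 'a \<times> nat \<times> nat" where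
  "algorithm_A g A c D G Gbar T K n m =
     (let \<eta> = G / (D * sqrt (real T));
          \<rho> = (Gbar / D) * sqrt (real T / real K);
          (q, y, vsum, n', m') = (outer_step g A c D \<eta> \<rho> K ^^ T) (0, c, 0, n, m)
      in ((1 / real T) *\<^sub>R vsum, n', m'))"

text \<open>The result is \<open>None\<close> if the loop does not terminate, and otherwise \<open>Some\<close> of the final
  state: point, final value of \<open>\<Delta>\<close>, oracle counter, subgradient counter.\<close>

definition algorithm_B ::
    "'a::euclidean_space subgrad_choice \<Rightarrow> ('a \<Rightarrow> real \<Rightarrow> 'a) \<Rightarrow> 'a \<Rightarrow> real \<Rightarrow> real \<Rightarrow> real
      \<Rightarrow> real \<Rightarrow> real \<Rightarrow> ('a \<times> real \<times> nat \<times> nat) option" where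
  "algorithm_B g A x_in \<Delta>\<^sub>0 \<alpha> \<epsilon> G Gbar =
     (let K = nat \<lceil>Gbar\<^sup>2 / G\<^sup>2\<rceil>
      in while_option
           (\<lambda>(x, \<Delta>, n, m). \<Delta> > \<epsilon>)
           (\<lambda>(x, \<Delta>, n, m).
              let D = sqrt (2 * \<Delta> / \<alpha>);
                  T = nat \<lceil>288 * G\<^sup>2 / (\<alpha> * \<Delta>)\<rceil>;
                  (x', n', m') = algorithm_A g A x D G Gbar T K n m
              in (x', 6 * G * sqrt (2 * \<Delta> / (\<alpha> * real T)), n', m'))
           (x_in, \<Delta>\<^sub>0, 0, 0))"

text \<open>
  Constants behind the two \<open>O\<close>-bounds. An existentially quantified constant inside a
  theorem about a type \<open>'a\<close> could depend on \<open>'a\<close>, hence on the dimension; universal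
  constants therefore have to be given as closed terms. With \<open>u = \<alpha> \<Delta> / G\<^sup>2\<close>, stages with
  \<open>u > 288\<close> use one oracle call and replace \<open>u / 72\<close> by its square root, so there are at most
  \<open>1 + 2 ln (1 + ln (1 + \<alpha> \<Delta>\<^sub>0 / G\<^sup>2))\<close> of them; the others at least halve \<open>\<Delta>\<close> and
  use at most \<open>2 * 288 * G\<^sup>2 / (\<alpha> \<Delta>)\<close> calls each, in total \<open>1152 * G\<^sup>2 / (\<alpha> \<epsilon>)\<close>.
  Each oracle call comes with at most \<open>2 * Gbar\<^sup>2 / G\<^sup>2\<close> subgradient calls.
\<close>

definition prox_call_const :: real where
  "prox_call_const = 1152"

definition subgrad_call_const :: real where
  "subgrad_call_const = 2304"

end

(* Each stage maintains the augmented-Lagrangian potential |q|^2/(2 eta) + rho/2 |y - x|^2 for the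
   minimizer x nearest to the centre. Adding the weak proximal inequality at c - q/(2 eta) to the
   optimality conditions of the projected steps, the term eta/2 |v - x|^2 is absorbed by
   eta |v - c|^2 + eta |x - c|^2, so the averages v and y satisfy
   R v + f y + (eta T/2) |v - y|^2 <= F* + (9/2) G D / sqrt T.
   The point v may leave the region where subgradients are known to be bounded by G, so the step
   f v <= f y + G |v - y| is obtained by moving along the segment from x to v inside the sublevel
   set; this gives the gap 5 G D / sqrt T, and the choice of T makes it at most half the current
   bound. The calls are counted with a potential: for u = alpha Delta / G^2 >= 288 the iterated
   logarithm of u drops by a constant, and for u < 288 the geometric decay of Delta pays. *)
theory Submission
  imports Defs
begin

section \<open>Averages and completed squares\<close>

text \<open>Deviations from the mean sum to zero, so the common slope \<open>h\<close> cancels: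
  Jensen's inequality with an explicit supporting affine function. The arbitrary bounds
  \<open>b i\<close> allow the right sides to be summed separately, for instance by
  telescoping.\<close>

lemma mean_affine_minorant:
  fixes p :: "nat \<Rightarrow> 'a::real_inner"
  assumes "K > 0" "m = (1 / real K) *\<^sub>R (\<Sum>i<K. p i)"
    and "\<And>i. i < K \<Longrightarrow> a + h \<bullet> (p i - m) \<le> b i"
  shows "real K * a \<le> (\<Sum>i<K. b i)"
proof -
  have "(\<Sum>i<K. p i - m) = 0"
    using assms(1,2) by (simp add: sum_subtractf sum_constant_scaleR)
  then have "(\<Sum>i<K. a + h \<bullet> (p i - m)) = real K * a"
    by (simp add: sum.distrib flip: inner_sum_right)
  then show ?thesis
    using sum_mono[of "{..<K}" "\<lambda>i. a + h \<bullet> (p i - m)" b] assms(3) by auto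
qed

lemma two_inner_diff:
  fixes a b p :: "'a::real_inner"
  shows "2 * ((a - p) \<bullet> (b - p)) = (norm (a - p))\<^sup>2 + (norm (b - p))\<^sup>2 - (norm (a - b))\<^sup>2"
  by (simp add: power2_norm_eq_inner inner_diff inner_commute)

lemma linear_minus_square_le:
  fixes a d k :: real
  assumes "k > 0"
  shows "a * d - k / 2 * d\<^sup>2 \<le> a\<^sup>2 / (2 * k)"
proof -
  have "0 \<le> (a - k * d)\<^sup>2 / (2 * k)"
    using assms by simp
  also have "\<dots> = a\<^sup>2 / (2 * k) - (a * d - k / 2 * d\<^sup>2)"
    using assms by (simp add: field_simps power2_eq_square)
  finally show ?thesis by simp
qed

section \<open>One stage: the potential argument\<close>

text \<open>A stage with free step sizes, compared with one fixed point \<open>x\<close>, later a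
  minimizer within distance \<open>D\<close> of the centre. \<open>S\<close> and \<open>r\<close>
  stand for the domain of the regularizer and its real values there, so that all estimates live in
  the reals.\<close>

locale prox_stage =
  fixes f :: "'a::euclidean_space \<Rightarrow> real" and r :: "'a \<Rightarrow> real" and S :: "'a set"
    and A :: "'a \<Rightarrow> real \<Rightarrow> 'a" and g :: "nat \<Rightarrow> 'a \<Rightarrow> 'a"
    and c x :: 'a and D \<eta> \<rho> Gbar :: real and K :: nat
  assumes D: "D > 0" and eta: "\<eta> > 0" and rho: "\<rho> > 0" and K: "K > 0" and Gbar: "Gbar > 0"
    and near: "norm (x - c) \<le> D"
    and subgrad: "\<And>m y. g m y \<in> subdifferential f y"
    and bound: "\<And>y h. y \<in> cball c D \<Longrightarrow> h \<in> subdifferential f y \<Longrightarrow> norm h \<le> Gbar"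
    and prox_in: "\<And>y. A y \<eta> \<in> S"
    and prox: "\<And>y. \<eta> * (norm (A y \<eta> - y))\<^sup>2 + r (A y \<eta>) \<le> \<eta> * (norm (x - y))\<^sup>2 + r x"
begin

lemma x_in_ball: "x \<in> cball c D"
  using near by (simp add: dist_norm norm_minus_commute)

lemma subgradD: "f y + g m y \<bullet> (z - y) \<le> f z"
  using subgrad[of m y] by (auto simp: subdifferential_def)

text \<open>The variational inequality of the projection, tested at \<open>x\<close> and multiplied
  by \<open>\<rho> * real K + \<eta>\<close>, splits into inner products that
  \<open>two_inner_diff\<close> turns into squared distances. The subgradient is taken at
  \<open>y\<close> while the value is wanted at \<open>p\<close>; the error
  \<open>2 * Gbar * norm (y - p)\<close> is absorbed by the squared movement from \<open>y\<close>
  to \<open>p\<close>, at the cost \<open>2 * Gbar\<^sup>2 / (\<rho> * real K)\<close>.\<close>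

lemma inner_step_bound:
  fixes q v y :: 'a and m :: nat
  defines "p \<equiv> closest_point (cball c D)
    ((1 / (\<rho> * real K + \<eta>)) *\<^sub>R ((\<rho> * real K) *\<^sub>R y + q + \<eta> *\<^sub>R v - g m y))"
  assumes y: "y \<in> cball c D"
  shows "p \<in> cball c D"
    and "f p - f x - q \<bullet> (p - x) + \<eta> / 2 * (norm (v - p))\<^sup>2 \<le>
      2 * Gbar\<^sup>2 / (\<rho> * real K) + \<eta> / 2 * (norm (v - x))\<^sup>2
      + \<rho> * real K / 2 * ((norm (y - x))\<^sup>2 - (norm (p - x))\<^sup>2)"
proof -
  define k where "k = \<rho> * real K"
  have k: "k > 0" using rho K by (simp add: k_def)
  define z where "z = (1 / (k + \<eta>)) *\<^sub>R (k *\<^sub>R y + q + \<eta> *\<^sub>R v - g m y)"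
  have p_def': "p = closest_point (cball c D) z" by (simp add: p_def z_def k_def)
  show p: "p \<in> cball c D"
    unfolding p_def' by (rule closest_point_in_set) (use D in auto)
  have zk: "(k + \<eta>) *\<^sub>R z = k *\<^sub>R y + q + \<eta> *\<^sub>R v - g m y"
    using k eta by (simp add: z_def)
  have "(z - p) \<bullet> (x - p) \<le> 0"
    unfolding p_def' by (rule closest_point_dot) (use x_in_ball in auto)
  then have "(k + \<eta>) * ((z - p) \<bullet> (x - p)) \<le> 0"
    using k eta by (simp add: mult_le_0_iff)
  also have "(k + \<eta>) * ((z - p) \<bullet> (x - p)) = ((k + \<eta>) *\<^sub>R z - (k + \<eta>) *\<^sub>R p) \<bullet> (x - p)"
    by (metis inner_scaleR_left scaleR_diff_right)
  also have "\<dots> = k * ((y - p) \<bullet> (x - p)) + \<eta> * ((v - p) \<bullet> (x - p)) + (q - g m y) \<bullet> (x - p)"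
    unfolding zk by (simp add: inner_diff inner_add algebra_simps)
  finally have "2 * (k * ((y - p) \<bullet> (x - p)) + \<eta> * ((v - p) \<bullet> (x - p)) + (q - g m y) \<bullet> (x - p)) \<le> 0"
    by simp
  then have 1: "k * ((norm (y - p))\<^sup>2 + (norm (x - p))\<^sup>2 - (norm (y - x))\<^sup>2)
      + \<eta> * ((norm (v - p))\<^sup>2 + (norm (x - p))\<^sup>2 - (norm (v - x))\<^sup>2)
      + 2 * ((q - g m y) \<bullet> (x - p)) \<le> 0"
    unfolding two_inner_diff[symmetric] by (simp add: algebra_simps)
  \<comment> \<open>The values at \<open>p\<close> and \<open>x\<close> are compared through
    \<open>y\<close>. Each of the two comparisons costs one \<open>Gbar * norm (y - p)\<close>,
    hence the factor 2 below.\<close>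
  have "f y + g m y \<bullet> (x - y) \<le> f x" "f p + g m p \<bullet> (y - p) \<le> f y"
    by (rule subgradD)+
  moreover have "\<bar>g m y \<bullet> (y - p)\<bar> \<le> Gbar * norm (y - p)" "\<bar>g m p \<bullet> (y - p)\<bar> \<le> Gbar * norm (y - p)"
    using Cauchy_Schwarz_ineq2 mult_right_mono[OF bound[OF y subgrad]]
      mult_right_mono[OF bound[OF p subgrad]] order_trans norm_ge_zero by metis+
  moreover have "g m y \<bullet> (x - p) = g m y \<bullet> (x - y) + g m y \<bullet> (y - p)"
    by (simp add: inner_diff)
  ultimately have 2: "f p - f x - 2 * Gbar * norm (y - p) \<le> - (g m y \<bullet> (x - p))"
    by linarith
  have 3: "2 * Gbar * norm (y - p) - k / 2 * (norm (y - p))\<^sup>2 \<le> 2 * Gbar\<^sup>2 / k"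
    using linear_minus_square_le[OF k, of "2 * Gbar" "norm (y - p)"] by simp
  \<comment> \<open>The square at \<open>x\<close> left over from the distance to \<open>v\<close>;
    it is discarded.\<close>
  have 4: "0 \<le> \<eta> * (norm (x - p))\<^sup>2" using eta by simp
  have "f p - f x - q \<bullet> (p - x) + \<eta> / 2 * (norm (v - p))\<^sup>2 \<le>
      2 * Gbar\<^sup>2 / k + \<eta> / 2 * (norm (v - x))\<^sup>2
      + k / 2 * ((norm (y - x))\<^sup>2 - (norm (p - x))\<^sup>2)"
    using 1 2 3 4 norm_minus_commute[of x p]
    by (simp add: inner_diff algebra_simps)
  then show "f p - f x - q \<bullet> (p - x) + \<eta> / 2 * (norm (v - p))\<^sup>2 \<le>
      2 * Gbar\<^sup>2 / (\<rho> * real K) + \<eta> / 2 * (norm (v - x))\<^sup>2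
      + \<rho> * real K / 2 * ((norm (y - x))\<^sup>2 - (norm (p - x))\<^sup>2)"
    by (simp add: k_def)
qed

text \<open>The left side of the one-step bound is convex in the new point apart from the
  \<open>\<rho>\<close> terms, so it passes to the mean of the new points. The \<open>\<rho>\<close>
  terms telescope, and division by \<open>real K\<close> turns their weight into
  \<open>\<rho> / 2\<close>.\<close>

lemma inner_loop_bound:
  assumes y: "y \<in> cball c D"
  obtains y' ysum where
    "(inner_step g c D \<eta> \<rho> K q v ^^ K) (y, 0, m) = (y', ysum, m + K)"
    "y' \<in> cball c D"
    "f ((1 / real K) *\<^sub>R ysum) - f x - q \<bullet> ((1 / real K) *\<^sub>R ysum - x)
        + \<eta> / 2 * (norm (v - (1 / real K) *\<^sub>R ysum))\<^sup>2 + \<rho> / 2 * (norm (y' - x))\<^sup>2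
      \<le> 2 * Gbar\<^sup>2 / (\<rho> * real K) + \<eta> / 2 * (norm (v - x))\<^sup>2 + \<rho> / 2 * (norm (y - x))\<^sup>2"
proof -
  \<comment> \<open>Query number \<open>m + i\<close> is made at \<open>p i\<close>. The mean runs
    over \<open>p 1\<close> to \<open>p K\<close>, the points whose values the one-step bound
    controls.\<close>
  define p where "p = rec_nat y (\<lambda>i w. closest_point (cball c D)
    ((1 / (\<rho> * real K + \<eta>)) *\<^sub>R ((\<rho> * real K) *\<^sub>R w + q + \<eta> *\<^sub>R v - g (m + i) w)))"
  have p0: "p 0 = y" by (simp add: p_def)
  have pS: "p (Suc i) = closest_point (cball c D)
    ((1 / (\<rho> * real K + \<eta>)) *\<^sub>R ((\<rho> * real K) *\<^sub>R p i + q + \<eta> *\<^sub>R v - g (m + i) (p i)))" for i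
    by (simp add: p_def)
  have run: "(inner_step g c D \<eta> \<rho> K q v ^^ s) (y, 0, m) = (p s, \<Sum>i<s. p (Suc i), m + s)" for s
    by (induction s) (auto simp: p0 inner_step_def pS Let_def)
  have ball: "p i \<in> cball c D" for i
    by (induction i) (use y inner_step_bound(1) in \<open>auto simp: p0 pS simp del: mem_cball\<close>)
  define yh where "yh = (1 / real K) *\<^sub>R (\<Sum>i<K. p (Suc i))"
  define C where "C = f yh - f x - q \<bullet> (yh - x) + \<eta> / 2 * (norm (v - yh))\<^sup>2"
  define d where "d i = (norm (p i - x))\<^sup>2" for i
  define B where "B = 2 * Gbar\<^sup>2 / (\<rho> * real K) + \<eta> / 2 * (norm (v - x))\<^sup>2"
  \<comment> \<open>A subgradient at \<open>yh\<close> of the function of \<open>u\<close> given by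
    \<open>f u - q \<bullet> u + \<eta> / 2 * (norm (v - u))\<^sup>2\<close>. The index 0 is
    arbitrary: \<open>g 0 yh\<close> merely supplies some subgradient of \<open>f\<close> at
    \<open>yh\<close> and is not a query of the algorithm.\<close>
  define h where "h = g 0 yh - q - \<eta> *\<^sub>R (v - yh)"
  have "C + h \<bullet> (p (Suc i) - yh) \<le> B + \<rho> * real K / 2 * (d i - d (Suc i))" for i
  proof -
    have "0 \<le> (norm (yh - p (Suc i)))\<^sup>2" by simp
    then have "(norm (v - yh))\<^sup>2 - 2 * ((v - yh) \<bullet> (p (Suc i) - yh)) \<le> (norm (v - p (Suc i)))\<^sup>2"
      unfolding power2_norm_eq_inner by (simp add: inner_diff inner_commute)
    then have "\<eta> / 2 * ((norm (v - yh))\<^sup>2 - 2 * ((v - yh) \<bullet> (p (Suc i) - yh)))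
        \<le> \<eta> / 2 * (norm (v - p (Suc i)))\<^sup>2"
      by (rule mult_left_mono) (use eta in simp)
    moreover have "f yh + g 0 yh \<bullet> (p (Suc i) - yh) \<le> f (p (Suc i))" by (rule subgradD)
    moreover have "h \<bullet> (p (Suc i) - yh) = g 0 yh \<bullet> (p (Suc i) - yh) - q \<bullet> (p (Suc i) - yh)
        - \<eta> * ((v - yh) \<bullet> (p (Suc i) - yh))"
      unfolding h_def by (simp only: inner_diff_left inner_scaleR_left)
    moreover have "q \<bullet> (p (Suc i) - x) = q \<bullet> (yh - x) + q \<bullet> (p (Suc i) - yh)"
      by (simp add: inner_diff)
    moreover have "f (p (Suc i)) - f x - q \<bullet> (p (Suc i) - x) + \<eta> / 2 * (norm (v - p (Suc i)))\<^sup>2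
        \<le> B + \<rho> * real K / 2 * (d i - d (Suc i))"
      using inner_step_bound(2)[OF ball[of i], of q v "m + i"]
      unfolding B_def d_def pS by simp
    moreover have "\<eta> / 2 * ((norm (v - yh))\<^sup>2 - 2 * ((v - yh) \<bullet> (p (Suc i) - yh))) =
        \<eta> / 2 * (norm (v - yh))\<^sup>2 - \<eta> * ((v - yh) \<bullet> (p (Suc i) - yh))"
      by (simp add: right_diff_distrib)
    ultimately show ?thesis unfolding C_def by linarith
  qed
  then have "real K * C \<le> (\<Sum>i<K. B + \<rho> * real K / 2 * (d i - d (Suc i)))"
    by (intro mean_affine_minorant[OF K yh_def])
  also have "\<dots> = real K * B + \<rho> * real K / 2 * (d 0 - d K)"
    by (simp only: sum.distrib sum_distrib_left[symmetric] sum_lessThan_telescope' sum_constant card_lessThan)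
  also have "\<dots> = real K * (B + \<rho> / 2 * (d 0 - d K))"
    by (simp add: algebra_simps)
  finally have "C \<le> B + \<rho> / 2 * (d 0 - d K)"
    using K by simp
  then have "C + \<rho> / 2 * d K \<le> B + \<rho> / 2 * d 0"
    unfolding right_diff_distrib by linarith
  then show ?thesis
    using that[OF run ball] unfolding C_def B_def d_def yh_def p0 by blast
qed

text \<open>The linear terms in \<open>q\<close> of the oracle inequality and of the inner loop
  combine to \<open>q \<bullet> (v - yh)\<close>. Together with the penalty on \<open>v - yh\<close>
  they are exactly the increase of \<open>(norm q)\<^sup>2 / (2 * \<eta>)\<close> under the update
  of \<open>q\<close>.\<close>

lemma outer_step_bound:
  assumes y: "y \<in> cball c D"
  obtains v yh y' where
    "outer_step g A c D \<eta> \<rho> K (q, y, vsum, n, m) = (q + \<eta> *\<^sub>R (v - yh), y', vsum + v, Suc n, m + K)"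
    "v \<in> S" "y' \<in> cball c D"
    "r v + f yh + (norm (q + \<eta> *\<^sub>R (v - yh)))\<^sup>2 / (2 * \<eta>) + \<rho> / 2 * (norm (y' - x))\<^sup>2
      \<le> r x + f x + 2 * \<eta> * D\<^sup>2 + 2 * Gbar\<^sup>2 / (\<rho> * real K)
        + (norm q)\<^sup>2 / (2 * \<eta>) + \<rho> / 2 * (norm (y - x))\<^sup>2"
proof -
  define v where "v = A (c - (1 / (2 * \<eta>)) *\<^sub>R q) \<eta>"
  obtain y' ysum where
    run: "(inner_step g c D \<eta> \<rho> K q v ^^ K) (y, 0, m) = (y', ysum, m + K)" and
    y': "y' \<in> cball c D" and
    "f ((1 / real K) *\<^sub>R ysum) - f x - q \<bullet> ((1 / real K) *\<^sub>R ysum - x)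
        + \<eta> / 2 * (norm (v - (1 / real K) *\<^sub>R ysum))\<^sup>2 + \<rho> / 2 * (norm (y' - x))\<^sup>2
      \<le> 2 * Gbar\<^sup>2 / (\<rho> * real K) + \<eta> / 2 * (norm (v - x))\<^sup>2 + \<rho> / 2 * (norm (y - x))\<^sup>2"
    using inner_loop_bound[OF y] by blast
  moreover define yh where "yh = (1 / real K) *\<^sub>R ysum"
  ultimately have inner: "f yh - f x - q \<bullet> (yh - x)
        + \<eta> / 2 * (norm (v - yh))\<^sup>2 + \<rho> / 2 * (norm (y' - x))\<^sup>2
      \<le> 2 * Gbar\<^sup>2 / (\<rho> * real K) + \<eta> / 2 * (norm (v - x))\<^sup>2 + \<rho> / 2 * (norm (y - x))\<^sup>2"
    by simp
  have step: "outer_step g A c D \<eta> \<rho> K (q, y, vsum, n, m)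
      = (q + \<eta> *\<^sub>R (v - yh), y', vsum + v, Suc n, m + K)"
    using run by (simp add: outer_step_def Let_def yh_def flip: v_def)
  \<comment> \<open>Completing the square: shifting the oracle centre by
    \<open>q / (2 * \<eta>)\<close> amounts to adding the linear term
    \<open>q \<bullet> (w - c)\<close>, up to a constant.\<close>
  have sq: "\<eta> * (norm (w - (c - (1 / (2 * \<eta>)) *\<^sub>R q)))\<^sup>2
      = \<eta> * (norm (w - c))\<^sup>2 + q \<bullet> (w - c) + (norm q)\<^sup>2 / (4 * \<eta>)" for w
  proof -
    have "w - (c - (1 / (2 * \<eta>)) *\<^sub>R q) = (w - c) + (1 / (2 * \<eta>)) *\<^sub>R q" by simp
    then show ?thesis
      using eta by (simp only: power2_norm_eq_inner inner_add_left inner_add_right)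
        (simp add: inner_commute field_simps power2_eq_square)
  qed
  have sq': "(norm (q + \<eta> *\<^sub>R w))\<^sup>2 / (2 * \<eta>)
      = (norm q)\<^sup>2 / (2 * \<eta>) + q \<bullet> w + \<eta> / 2 * (norm w)\<^sup>2" for w
    using eta by (simp only: power2_norm_eq_inner inner_add_left inner_add_right)
      (simp add: inner_commute field_simps power2_eq_square)
  have "\<eta> * (norm (v - c))\<^sup>2 + q \<bullet> (v - c) + r v \<le> \<eta> * (norm (x - c))\<^sup>2 + q \<bullet> (x - c) + r x"
    using prox[of "c - (1 / (2 * \<eta>)) *\<^sub>R q"] unfolding v_def[symmetric] sq by simp
  \<comment> \<open>An exact proximal point would provide a negative multiple of
    \<open>(norm (v - x))\<^sup>2\<close> by strong convexity. The weak oracle does not, so its own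
    quadratic at \<open>v\<close> is spent instead, together with a second
    \<open>\<eta> * (norm (x - c))\<^sup>2\<close>; this yields
    \<open>2 * \<eta> * D\<^sup>2\<close>.\<close>
  moreover have "\<eta> / 2 * (norm (v - x))\<^sup>2 \<le> \<eta> * (norm (v - c))\<^sup>2 + \<eta> * (norm (x - c))\<^sup>2"
  proof -
    have "(norm (v - x))\<^sup>2 = 2 * ((norm (v - c))\<^sup>2 + (norm (x - c))\<^sup>2) - (norm ((v - c) + (x - c)))\<^sup>2"
      by (simp add: power2_norm_eq_inner inner_diff inner_add inner_commute)
    then have "(norm (v - x))\<^sup>2 \<le> 2 * ((norm (v - c))\<^sup>2 + (norm (x - c))\<^sup>2)"
      using zero_le_power2[of "norm ((v - c) + (x - c))"] by argo
    from mult_left_mono[OF this, of "\<eta> / 2"] eta show ?thesis by (simp add: algebra_simps)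
  qed
  moreover have "\<eta> * (norm (x - c))\<^sup>2 \<le> \<eta> * D\<^sup>2"
    using near eta by (intro mult_left_mono power_mono) auto
  moreover note sq'[of "v - yh"]
  moreover have "q \<bullet> (v - yh) = q \<bullet> (v - c) - q \<bullet> (x - c) - q \<bullet> (yh - x)"
    by (simp add: inner_diff)
  ultimately have "r v + f yh + (norm (q + \<eta> *\<^sub>R (v - yh)))\<^sup>2 / (2 * \<eta>) + \<rho> / 2 * (norm (y' - x))\<^sup>2
      \<le> r x + f x + 2 * \<eta> * D\<^sup>2 + 2 * Gbar\<^sup>2 / (\<rho> * real K)
        + (norm q)\<^sup>2 / (2 * \<eta>) + \<rho> / 2 * (norm (y - x))\<^sup>2"
    using inner by linarith
  moreover have "v \<in> S" unfolding v_def by (rule prox_in)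
  ultimately show ?thesis using that step y' by blast
qed

text \<open>The potential telescopes because both \<open>q\<close> and the last inner point are
  handed to the next outer step. It starts with \<open>q\<close> zero and \<open>y\<close> at the
  centre, so its initial value is at most \<open>\<rho> / 2 * D\<^sup>2\<close>.\<close>

lemma outer_loop_bound:
  obtains v yh :: "nat \<Rightarrow> 'a" and q y where
    "(outer_step g A c D \<eta> \<rho> K ^^ T) (0, c, 0, n, m) = (q, y, (\<Sum>i<T. v i), n + T, m + T * K)"
    "q = \<eta> *\<^sub>R (\<Sum>i<T. v i - yh i)"
    "\<And>i. v i \<in> S"
    "(\<Sum>i<T. r (v i) + f (yh i)) + (norm q)\<^sup>2 / (2 * \<eta>)
      \<le> real T * (r x + f x + 2 * \<eta> * D\<^sup>2 + 2 * Gbar\<^sup>2 / (\<rho> * real K)) + \<rho> / 2 * D\<^sup>2"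
proof -
  define st where "st t = (outer_step g A c D \<eta> \<rho> K ^^ t) (0, c, 0, n, m)" for t
  define Q where "Q t = fst (st t)" for t
  define Y where "Y t = fst (snd (st t))" for t
  define V where "V t = fst (snd (snd (st t)))" for t
  define N where "N t = fst (snd (snd (snd (st t))))" for t
  define M where "M t = snd (snd (snd (snd (st t))))" for t
  define B where "B = r x + f x + 2 * \<eta> * D\<^sup>2 + 2 * Gbar\<^sup>2 / (\<rho> * real K)"
  define P where "P t = (norm (Q t))\<^sup>2 / (2 * \<eta>) + \<rho> / 2 * (norm (Y t - x))\<^sup>2" for t
  have st: "st t = (Q t, Y t, V t, N t, M t)" for t
    by (simp add: Q_def Y_def V_def N_def M_def)
  have stS: "st (Suc t) = outer_step g A c D \<eta> \<rho> K (Q t, Y t, V t, N t, M t)" for t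
    unfolding st[symmetric] by (simp add: st_def)
  have st0: "Q 0 = 0" "Y 0 = c" "V 0 = 0" "N 0 = n" "M 0 = m"
    by (simp_all add: Q_def Y_def V_def N_def M_def st_def)
  have ball: "Y t \<in> cball c D" for t
  proof (induction t)
    case 0
    show ?case using D st0 by simp
  next
    case (Suc t)
    from outer_step_bound[OF Suc, of "Q t" "V t" "N t" "M t"] show ?case
      using stS[of t] st[of "Suc t"] by (metis prod.inject)
  qed
  have "\<exists>v yh. Q (Suc t) = Q t + \<eta> *\<^sub>R (v - yh) \<and> V (Suc t) = V t + v \<and> N (Suc t) = Suc (N t) \<and>
      M (Suc t) = M t + K \<and> v \<in> S \<and> r v + f yh + P (Suc t) \<le> B + P t" for t
  proof -
    obtain v yh y' where *:
      "outer_step g A c D \<eta> \<rho> K (Q t, Y t, V t, N t, M t)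
        = (Q t + \<eta> *\<^sub>R (v - yh), y', V t + v, Suc (N t), M t + K)"
      "v \<in> S"
      "r v + f yh + (norm (Q t + \<eta> *\<^sub>R (v - yh)))\<^sup>2 / (2 * \<eta>) + \<rho> / 2 * (norm (y' - x))\<^sup>2
        \<le> r x + f x + 2 * \<eta> * D\<^sup>2 + 2 * Gbar\<^sup>2 / (\<rho> * real K)
          + (norm (Q t))\<^sup>2 / (2 * \<eta>) + \<rho> / 2 * (norm (Y t - x))\<^sup>2"
      using outer_step_bound[OF ball[of t]] by metis
    have "Q (Suc t) = Q t + \<eta> *\<^sub>R (v - yh)" "Y (Suc t) = y'" "V (Suc t) = V t + v"
      "N (Suc t) = Suc (N t)" "M (Suc t) = M t + K"
      using *(1) stS[of t] st[of "Suc t"] by simp_all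
    then show ?thesis using *(2,3) unfolding P_def B_def by force
  qed
  then obtain v yh where
    Q: "\<And>t. Q (Suc t) = Q t + \<eta> *\<^sub>R (v t - yh t)" and V: "\<And>t. V (Suc t) = V t + v t" and
    N: "\<And>t. N (Suc t) = Suc (N t)" and M: "\<And>t. M (Suc t) = M t + K" and vS: "\<And>t. v t \<in> S" and
    P: "\<And>t. r (v t) + f (yh t) + P (Suc t) \<le> B + P t"
    by metis
  have Q': "Q t = \<eta> *\<^sub>R (\<Sum>i<t. v i - yh i)" for t
    by (induction t) (auto simp: st0 Q algebra_simps)
  have V': "V t = (\<Sum>i<t. v i)" for t by (induction t) (auto simp: st0 V)
  have N': "N t = n + t" for t by (induction t) (auto simp: st0 N)
  have M': "M t = m + t * K" for t by (induction t) (auto simp: st0 M)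
  have P': "(\<Sum>i<t. r (v i) + f (yh i)) + P t \<le> real t * B + P 0" for t
  proof (induction t)
    case (Suc t)
    then show ?case using P[of t] by (simp add: algebra_simps)
  qed simp
  have "(\<Sum>i<T. r (v i) + f (yh i)) + (norm (Q T))\<^sup>2 / (2 * \<eta>) \<le> real T * B + \<rho> / 2 * D\<^sup>2"
  proof -
    have "P 0 \<le> \<rho> / 2 * D\<^sup>2"
      using near rho by (simp add: P_def st0 norm_minus_commute power_mono)
    moreover have "(norm (Q T))\<^sup>2 / (2 * \<eta>) \<le> P T" using rho by (simp add: P_def)
    ultimately show ?thesis using P'[of T] by linarith
  qed
  then show ?thesis
    using that[of "Q T" "Y T" v yh] st[of T] Q'[of T] vS unfolding st_def V' N' M' B_def by blast
qed

text \<open>Since \<open>q\<close> accumulates \<open>\<eta>\<close> times the mismatches, it equals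
  \<open>\<eta> * real T\<close> times the difference of the averages. The final potential thereby
  becomes a quadratic penalty on \<open>v - y\<close>, while Jensen's inequality handles
  \<open>r\<close> at \<open>v\<close> and \<open>f\<close> at \<open>y\<close>.\<close>

lemma averaged_bound:
  assumes T: "T > 0" and r: "convex_on S r"
  obtains v y q y' vsum where
    "(outer_step g A c D \<eta> \<rho> K ^^ T) (0, c, 0, n, m) = (q, y', vsum, n + T, m + T * K)"
    "v = (1 / real T) *\<^sub>R vsum" "v \<in> S"
    "r v + f y + \<eta> * real T / 2 * (norm (v - y))\<^sup>2
      \<le> r x + f x + 2 * \<eta> * D\<^sup>2 + 2 * Gbar\<^sup>2 / (\<rho> * real K) + \<rho> * D\<^sup>2 / (2 * real T)"
proof -
  obtain w yh :: "nat \<Rightarrow> 'a" and q y' where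
    run: "(outer_step g A c D \<eta> \<rho> K ^^ T) (0, c, 0, n, m) = (q, y', (\<Sum>i<T. w i), n + T, m + T * K)" and
    q: "q = \<eta> *\<^sub>R (\<Sum>i<T. w i - yh i)" and wS: "\<And>i. w i \<in> S" and
    b: "(\<Sum>i<T. r (w i) + f (yh i)) + (norm q)\<^sup>2 / (2 * \<eta>)
      \<le> real T * (r x + f x + 2 * \<eta> * D\<^sup>2 + 2 * Gbar\<^sup>2 / (\<rho> * real K)) + \<rho> / 2 * D\<^sup>2"
    by (rule outer_loop_bound[of T n m]) (rule that; assumption)
  define v where "v = (1 / real T) *\<^sub>R (\<Sum>i<T. w i)"
  define y where "y = (1 / real T) *\<^sub>R (\<Sum>i<T. yh i)"
  have S: "convex S" using r by (rule convex_on_imp_convex)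
  have v: "v = (\<Sum>i<T. (1 / real T) *\<^sub>R w i)" by (simp add: v_def scaleR_sum_right)
  have vS: "v \<in> S" unfolding v
    by (rule convex_sum[OF _ S]) (use T wS in auto)
  have "r v \<le> (\<Sum>i<T. (1 / real T) * r (w i))" unfolding v
    by (rule convex_on_sum[OF _ _ r]) (use T wS in auto)
  then have rv: "real T * r v \<le> (\<Sum>i<T. r (w i))"
    using T by (simp add: field_simps flip: sum_divide_distrib)
  have fy: "real T * f y \<le> (\<Sum>i<T. f (yh i))"
    by (rule mean_affine_minorant[OF T y_def subgradD])
  have "q = (\<eta> * real T) *\<^sub>R (v - y)"
    using T by (simp add: q v_def y_def sum_subtractf scaleR_diff_right)
  then have nq: "norm q = \<eta> * real T * norm (v - y)" using eta by simp
  have "(norm q)\<^sup>2 / (2 * \<eta>) = real T * (\<eta> * real T / 2 * (norm (v - y))\<^sup>2)"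
    unfolding nq using eta by (simp add: power2_eq_square)
  moreover have "\<rho> / 2 * D\<^sup>2 = real T * (\<rho> * D\<^sup>2 / (2 * real T))" using T by simp
  ultimately have "real T * (r v + f y + \<eta> * real T / 2 * (norm (v - y))\<^sup>2) \<le>
     real T * (r x + f x + 2 * \<eta> * D\<^sup>2 + 2 * Gbar\<^sup>2 / (\<rho> * real K) + \<rho> * D\<^sup>2 / (2 * real T))"
    using b rv fy by (simp only: sum.distrib distrib_left)
  then have "r v + f y + \<eta> * real T / 2 * (norm (v - y))\<^sup>2
      \<le> r x + f x + 2 * \<eta> * D\<^sup>2 + 2 * Gbar\<^sup>2 / (\<rho> * real K) + \<rho> * D\<^sup>2 / (2 * real T)"
    using T by (simp only: mult_le_cancel_left_pos of_nat_0_less_iff)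
  then show ?thesis using that run v_def vS by blast
qed

end

section \<open>From the penalized bound to the objective gap\<close>

text \<open>Given \<open>f v \<le> f y + G * norm (v - y)\<close>, the quadratic penalty in
  \<open>key\<close> would absorb the last term at the cost \<open>G\<^sup>2 / (2 * k)\<close>.
  Along the segment from \<open>x\<close> to \<open>v\<close> this argument works at each point
  already known to lie in the sublevel set, and it returns a gap strictly below the level
  \<open>E\<close>, which allows a continuation up to \<open>v\<close>.\<close>

lemma gap_bound_via_segment:
  fixes f r :: "'a::euclidean_space \<Rightarrow> real"
  assumes f: "convex_on UNIV f" and r: "convex_on S r" and sub: "\<And>u. subdifferential f u \<noteq> {}"
    and x: "x \<in> S" and v: "v \<in> S"
    and lip: "\<And>w h. w \<in> S \<Longrightarrow> f w + r w \<le> f x + r x + E \<Longrightarrow> h \<in> subdifferential f w \<Longrightarrow> norm h \<le> G"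
    and key: "r v + f y + k / 2 * (norm (v - y))\<^sup>2 \<le> r x + f x + B"
    and k: "k > 0" and B: "B \<ge> 0" and E: "B + G\<^sup>2 / (2 * k) < E"
  shows "f v + r v \<le> f x + r x + B + G\<^sup>2 / (2 * k)"
proof -
  define C where "C = B + G\<^sup>2 / (2 * k)"
  have C: "0 \<le> C" "C < E" using k B E by (auto simp: C_def)
  define F where "F u = f u + r u - (f x + r x)" for u
  have S: "convex S" using r by (rule convex_on_imp_convex)
  have fS: "convex_on S f" using f convex_on_subset[OF f] S by auto
  have Fconv: "F ((1 - t) *\<^sub>R a + t *\<^sub>R b) \<le> (1 - t) * F a + t * F b"
    if "a \<in> S" "b \<in> S" "0 \<le> t" "t \<le> 1" for a b t
    using convex_onD[OF r, of t a b] convex_onD[OF fS, of t a b] that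
    by (simp add: F_def algebra_simps)
  define w where "w t = (1 - t) *\<^sub>R x + t *\<^sub>R v" for t
  \<comment> \<open>The companion of \<open>w t\<close> on the segment from \<open>x\<close> to
    \<open>y\<close>: the two points differ by \<open>t\<close> times \<open>v - y\<close>, so every
    term of the estimate scales with \<open>t\<close>.\<close>
  define z where "z t = (1 - t) *\<^sub>R x + t *\<^sub>R y" for t
  have wS: "w t \<in> S" if "0 \<le> t" "t \<le> 1" for t
    unfolding w_def using S x v that by (intro convexD) auto
  have lip': "f (w t) \<le> f (z t) + G * (t * norm (v - y))"
    if "0 \<le> t" "t \<le> 1" "F (w t) \<le> E" for t
  proof -
    obtain h where h: "h \<in> subdifferential f (w t)" using sub by blast
    have "norm h \<le> G" using lip[OF wS _ h] that by (simp add: F_def)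
    moreover have "w t - z t = t *\<^sub>R (v - y)" by (simp add: w_def z_def algebra_simps)
    then have "norm (w t - z t) = t * norm (v - y)" using that by simp
    ultimately have "h \<bullet> (w t - z t) \<le> G * (t * norm (v - y))"
      by (metis norm_cauchy_schwarz mult_right_mono norm_ge_zero order_trans)
    moreover have "f (w t) + h \<bullet> (z t - w t) \<le> f (z t)"
      using h by (auto simp: subdifferential_def)
    ultimately show ?thesis by (simp add: inner_diff)
  qed
  have square: "G * norm (v - y) - k / 2 * (norm (v - y))\<^sup>2 \<le> G\<^sup>2 / (2 * k)"
    by (rule linear_minus_square_le[OF k])
  have small: "F (w t) \<le> C" if t: "0 \<le> t" "t \<le> 1" "F (w t) \<le> E" for t
  proof -
    have "r (w t) \<le> (1 - t) * r x + t * r v"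
      using convex_onD[OF r, of t x v] t x v by (simp add: w_def)
    moreover have "f (z t) \<le> (1 - t) * f x + t * f y"
      using convex_onD[OF f, of t x y] t by (simp add: z_def)
    ultimately have "F (w t) \<le> t * (r v + f y - (r x + f x) + G * norm (v - y))"
      using lip'[OF t] by (simp add: F_def algebra_simps)
    also have "\<dots> \<le> t * C"
      using key square t by (intro mult_left_mono) (auto simp: C_def)
    also have "\<dots> \<le> C" using t C by (simp add: mult_left_le_one_le)
    finally show ?thesis .
  qed
  \<comment> \<open>Chosen so that \<open>l * (E - C + \<bar>F v\<bar>) = E - C\<close>: moving the
    fraction \<open>l\<close> towards \<open>v\<close> raises the bound \<open>C\<close> by at most
    \<open>E - C\<close>.\<close>
  define l where "l = (E - C) / (E - C + \<bar>F v\<bar>)"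
  have l: "0 < l" "l \<le> 1" using C by (auto simp: l_def field_simps)
  have lF: "(1 - l) * C + l * F v \<le> E"
  proof -
    have "l * F v \<le> l * (E - C + \<bar>F v\<bar>)" using l C by (intro mult_left_mono) auto
    also have "\<dots> = E - C" using C by (simp add: l_def)
    finally have "l * F v \<le> E - C" .
    moreover have "(1 - l) * C \<le> C" using l C by (simp add: mult_left_le_one_le)
    ultimately show ?thesis by simp
  qed
  \<comment> \<open>Nothing is known about subgradients beyond the sublevel set, and \<open>v\<close> might lie outside it;
    but as soon as a point of the segment has gap at most \<open>E\<close>, its gap is at most \<open>C < E\<close>, which
    leaves room to move on towards \<open>v\<close> by the fixed fraction \<open>l\<close> of the remaining distance.\<close>
  define t where "t n = 1 - (1 - l) ^ n" for n :: nat
  have t01: "0 \<le> t n" "t n \<le> 1" for n using l by (auto simp: t_def power_le_one)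
  have tE: "F (w (t n)) \<le> E" for n
  proof (induction n)
    case 0
    show ?case using C by (simp add: t_def w_def F_def)
  next
    case (Suc n)
    have "w (t (Suc n)) = (1 - l) *\<^sub>R w (t n) + l *\<^sub>R v"
      by (simp add: w_def t_def algebra_simps)
    then have "F (w (t (Suc n))) \<le> (1 - l) * F (w (t n)) + l * F v"
      using Fconv[OF wS[OF t01] v, of l] l by simp
    also have "\<dots> \<le> (1 - l) * C + l * F v"
      using small[OF t01 Suc] l by (intro add_right_mono mult_left_mono) auto
    finally show ?case using lF by simp
  qed
  have tlim: "t \<longlonglongrightarrow> 1"
  proof -
    have "(\<lambda>n. (1 - l) ^ n) \<longlonglongrightarrow> 0" using l by (intro LIMSEQ_power_zero) auto
    from tendsto_diff[OF tendsto_const[of 1] this] show ?thesis unfolding t_def by simp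
  qed
  \<comment> \<open>The limit is taken in the inequality between values of \<open>f\<close>, which
    is continuous as a finite convex function; \<open>r v\<close> enters afterwards through
    \<open>key\<close>.\<close>
  have fc: "isCont f u" for u
    using convex_on_continuous[OF open_UNIV f] by (simp add: continuous_on_eq_continuous_at)
  have "(\<lambda>n. f (w (t n))) \<longlonglongrightarrow> f (w 1)" "(\<lambda>n. f (z (t n))) \<longlonglongrightarrow> f (z 1)"
    unfolding w_def z_def by (intro isCont_tendsto_compose[OF fc] tendsto_intros tlim)+
  moreover have "(\<lambda>n. f (z (t n)) + G * (t n * norm (v - y))) \<longlonglongrightarrow> f (z 1) + G * (1 * norm (v - y))"
    by (intro tendsto_intros tlim calculation)
  ultimately have "f (w 1) \<le> f (z 1) + G * (1 * norm (v - y))"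
    using lip'[OF t01 tE] by (intro LIMSEQ_le) auto
  then have "f v \<le> f y + G * norm (v - y)" by (simp add: w_def z_def)
  then show ?thesis using key square by linarith
qed

text \<open>With \<open>e = G * D / sqrt (real T)\<close>, the step sizes give \<open>2 * e\<close>
  from the centre term. The two terms with \<open>Gbar\<close> are 2 and 1/2 times
  \<open>Gbar * D / sqrt (real T * real K)\<close>, which is at most \<open>e\<close> by the size of
  \<open>K\<close>. The passage to the gap adds \<open>e / 2\<close>, for a total of
  \<open>5 * e\<close>.\<close>

lemma algorithm_A_bound:
  fixes f r :: "'a::euclidean_space \<Rightarrow> real"
  assumes f: "convex_on UNIV f" and r: "convex_on S r"
    and subgrad: "\<And>m y. g m y \<in> subdifferential f y"
    and prox_in: "\<And>y l. l > 0 \<Longrightarrow> A y l \<in> S"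
    and prox: "\<And>y l. l > 0 \<Longrightarrow> l * (norm (A y l - y))\<^sup>2 + r (A y l) \<le> l * (norm (x - y))\<^sup>2 + r x"
    and x: "x \<in> S" and near: "norm (x - c) \<le> D"
    and D: "D > 0" and T: "T > 0" and K: "K > 0" and G: "G > 0" "G \<le> Gbar"
    and Kbig: "Gbar\<^sup>2 \<le> G\<^sup>2 * real K"
    and bound: "\<And>y h. y \<in> cball c D \<Longrightarrow> h \<in> subdifferential f y \<Longrightarrow> norm h \<le> Gbar"
    and lip: "\<And>w h. w \<in> S \<Longrightarrow> f w + r w \<le> f x + r x + E \<Longrightarrow> h \<in> subdifferential f w \<Longrightarrow> norm h \<le> G"
    and E: "5 * (G * D / sqrt (real T)) < E"
  obtains v where "algorithm_A g A c D G Gbar T K n m = (v, n + T, m + T * K)" "v \<in> S"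
    "f v + r v \<le> f x + r x + 5 * (G * D / sqrt (real T))"
proof -
  define s where "s = sqrt (real T)"
  define \<kappa> where "\<kappa> = sqrt (real K)"
  define e where "e = G * D / s"
  have s: "s > 0" "real T = s\<^sup>2" using T by (auto simp: s_def)
  have \<kappa>: "\<kappa> > 0" "real K = \<kappa>\<^sup>2" using K by (auto simp: \<kappa>_def)
  define \<eta> where "\<eta> = G / (D * s)"
  define \<rho> where "\<rho> = (Gbar / D) * (s / \<kappa>)"
  have E': "5 * e < E" using E unfolding e_def s_def .
  have pos: "\<eta> > 0" "\<rho> > 0" "Gbar > 0" "e > 0"
    using D G s \<kappa> by (auto simp: \<eta>_def \<rho>_def e_def)
  interpret prox_stage f r S A g c x D \<eta> \<rho> Gbar K
    using D pos K near subgrad bound prox_in[OF pos(1)] prox[OF pos(1)]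
    by unfold_locales
  obtain v y q y' vsum where
    run: "(outer_step g A c D \<eta> \<rho> K ^^ T) (0, c, 0, n, m) = (q, y', vsum, n + T, m + T * K)" and
    v: "v = (1 / real T) *\<^sub>R vsum" "v \<in> S" and
    key: "r v + f y + \<eta> * real T / 2 * (norm (v - y))\<^sup>2
      \<le> r x + f x + 2 * \<eta> * D\<^sup>2 + 2 * Gbar\<^sup>2 / (\<rho> * real K) + \<rho> * D\<^sup>2 / (2 * real T)"
    by (rule averaged_bound[OF T r])
  have "Gbar\<^sup>2 \<le> (G * \<kappa>)\<^sup>2" using Kbig \<kappa> by (simp add: power_mult_distrib)
  then have Gk: "Gbar \<le> G * \<kappa>" by (rule power2_le_imp_le) (use G \<kappa> in simp)
  have "Gbar * D / (s * \<kappa>) \<le> e"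
  proof -
    have "Gbar * D / (s * \<kappa>) \<le> (G * \<kappa>) * D / (s * \<kappa>)"
      using Gk D s \<kappa> by (intro divide_right_mono mult_right_mono) auto
    also have "\<dots> = e" using \<kappa> by (simp add: e_def)
    finally show ?thesis .
  qed
  moreover have "2 * \<eta> * D\<^sup>2 = 2 * e"
    using D by (simp add: \<eta>_def e_def power2_eq_square)
  moreover have "2 * Gbar\<^sup>2 / (\<rho> * real K) = 2 * (Gbar * D / (s * \<kappa>))"
    using D s \<kappa> pos by (simp add: \<rho>_def power2_eq_square field_simps)
  moreover have "\<rho> * D\<^sup>2 / (2 * real T) = (Gbar * D / (s * \<kappa>)) / 2"
    using D s \<kappa> pos by (simp add: \<rho>_def power2_eq_square field_simps)
  ultimately have key': "r v + f y + \<eta> * real T / 2 * (norm (v - y))\<^sup>2 \<le> r x + f x + 9 / 2 * e"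
    using key by argo
  have half: "G\<^sup>2 / (2 * (\<eta> * real T)) = e / 2"
    using D s G by (simp add: \<eta>_def e_def power2_eq_square field_simps)
  have "f v + r v \<le> f x + r x + 9 / 2 * e + G\<^sup>2 / (2 * (\<eta> * real T))"
  proof (rule gap_bound_via_segment[OF f r _ x v(2) lip key'])
    show "subdifferential f u \<noteq> {}" for u using subgrad by blast
    show "9 / 2 * e + G\<^sup>2 / (2 * (\<eta> * real T)) < E"
      using E' unfolding half by simp
  qed (use pos s in auto)
  then have "f v + r v \<le> f x + r x + 5 * e" unfolding half by simp
  moreover have "algorithm_A g A c D G Gbar T K n m = (v, n + T, m + T * K)"
    unfolding algorithm_A_def Let_def real_sqrt_divide
      s_def[symmetric] \<kappa>_def[symmetric] \<eta>_def[symmetric] \<rho>_def[symmetric] run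
    by (simp add: v(1))
  ultimately show ?thesis using that v(2) by (simp add: e_def s_def)
qed

section \<open>Counting oracle calls\<close>

text \<open>A bound on the oracle calls still to come from accuracy \<open>\<Delta>\<close>. Halving
  \<open>\<Delta>\<close> lowers the second summand by at least
  \<open>G\<^sup>2 / (2 * \<alpha> * \<Delta>)\<close>, yet it never exceeds
  \<open>G\<^sup>2 / (\<alpha> * \<epsilon>)\<close>. It is cut to 0 once the loop has ended, where
  the formula could turn negative.\<close>

definition call_potential :: "real \<Rightarrow> real \<Rightarrow> real \<Rightarrow> real \<Rightarrow> real" where
  "call_potential \<alpha> \<epsilon> G \<Delta> = prox_call_const *
     (ln (1 + ln (1 + \<alpha> * \<Delta> / G\<^sup>2)) + (if \<Delta> > \<epsilon> then G\<^sup>2 / \<alpha> * (1 / \<epsilon> - 1 / (2 * \<Delta>)) else 0))"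

lemma loglog_mono:
  fixes u u' :: real
  assumes "0 \<le> u'" "u' \<le> u"
  shows "ln (1 + ln (1 + u')) \<le> ln (1 + ln (1 + u))"
  using assms by (simp add: add_pos_nonneg)

text \<open>Beyond 288 the square root wins against the factor 72 so clearly that
  \<open>ln (1 + u)\<close> shrinks to at most 9/10 of itself, the numerical core being
  \<open>74 ^ 5 \<le> 289 ^ 4\<close>. As this logarithm is at least 1, one more logarithm drops by
  at least 1/20.\<close>

lemma loglog_drop:
  fixes u u' :: real
  assumes u: "u \<ge> 288" and u': "u' \<ge> 0" "u' \<le> u / 2" and eq: "u'\<^sup>2 = 72 * u"
  shows "ln (1 + ln (1 + u')) + 1 / 20 \<le> ln (1 + ln (1 + u))"
proof -
  define L where "L = ln (1 + u)"
  define L' where "L' = ln (1 + u')"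
  have "(1 + u')\<^sup>2 \<le> 74 * (1 + u)"
    using eq u' by (simp add: power2_eq_square algebra_simps)
  then have "((1 + u')\<^sup>2) ^ 5 \<le> (74 * (1 + u)) ^ 5"
    by (rule power_mono) simp
  also have "(74 * (1 + u)) ^ 5 = 74 ^ 5 * (1 + u) ^ 5"
    by (rule power_mult_distrib)
  also have "\<dots> \<le> (1 + u) ^ 4 * (1 + u) ^ 5"
  proof (rule mult_right_mono)
    have "(74::real) ^ 5 \<le> 289 ^ 4" by simp
    also have "\<dots> \<le> (1 + u) ^ 4" using u by (intro power_mono) auto
    finally show "(74::real) ^ 5 \<le> (1 + u) ^ 4" .
  qed (use u in simp)
  also have "\<dots> = (1 + u) ^ 9" by (simp flip: power_add)
  finally have "(1 + u') ^ 10 \<le> (1 + u) ^ 9" by (simp flip: power_mult)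
  then have "ln ((1 + u') ^ 10) \<le> ln ((1 + u) ^ 9)"
    using u' u by simp
  then have LL: "10 * L' \<le> 9 * L"
    using u' u by (simp add: ln_realpow L_def L'_def)
  have L': "0 \<le> L'" using u' by (simp add: L'_def)
  have "exp 1 \<le> 1 + u" using exp_le u by linarith
  then have L: "1 \<le> L" using u by (simp add: L_def ln_ge_iff)
  have "ln ((1 + L') / (1 + L)) \<le> (1 + L') / (1 + L) - 1"
    using L L' by (intro ln_le_minus_one) auto
  also have "\<dots> = (L' - L) / (1 + L)" using L by (simp add: field_simps)
  also have "\<dots> \<le> - (1 / 20)" using L LL by (simp add: field_simps)
  finally show ?thesis
    using L L' by (simp add: ln_div flip: L_def L'_def)
qed

text \<open>There are two regimes for \<open>u\<close>. From 288 on, \<open>T\<close> is 1 and the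
  iterated logarithm pays, since \<open>1152 / 20\<close> exceeds 1. Below 288, \<open>T\<close> is
  at most \<open>576 / u\<close>, which is 1152 times the drop \<open>1 / (2 * u)\<close> of the
  other summand.\<close>

lemma call_potential_decrease:
  fixes \<alpha> \<epsilon> G \<Delta> :: real
  defines "T \<equiv> nat \<lceil>288 * G\<^sup>2 / (\<alpha> * \<Delta>)\<rceil>"
  defines "\<Delta>' \<equiv> 6 * G * sqrt (2 * \<Delta> / (\<alpha> * real T))"
  assumes pos: "\<alpha> > 0" "\<epsilon> > 0" "G > 0" and \<Delta>: "\<Delta> > \<epsilon>"
  shows "T > 0" "\<Delta>' > 0" "\<Delta>' \<le> \<Delta> / 2"
    "real T + call_potential \<alpha> \<epsilon> G \<Delta>' \<le> call_potential \<alpha> \<epsilon> G \<Delta>"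
proof -
  have \<Delta>0: "\<Delta> > 0" using pos \<Delta> by simp
  define u where "u = \<alpha> * \<Delta> / G\<^sup>2"
  have u: "u > 0" using pos \<Delta>0 by (simp add: u_def)
  have uT: "288 * G\<^sup>2 / (\<alpha> * \<Delta>) = 288 / u" using pos by (simp add: u_def)
  have T_def': "T = nat \<lceil>288 / u\<rceil>" by (simp add: T_def uT)
  have Tpos: "T > 0" using u by (simp add: T_def')
  then show "T > 0" .
  have Tlow: "288 / u \<le> real T" unfolding T_def' by (rule real_nat_ceiling_ge)
  show \<Delta>'pos: "\<Delta>' > 0" using pos \<Delta>0 Tpos by (simp add: \<Delta>'_def)
  have sq: "\<Delta>'\<^sup>2 = 72 * \<Delta>\<^sup>2 / (u * real T)"
    using pos \<Delta>0 Tpos u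
    by (simp add: \<Delta>'_def u_def power_mult_distrib power2_eq_square[of \<Delta>])
  \<comment> \<open>As \<open>288 = 4 * 72\<close>, this makes \<open>\<Delta>'\<close> at most half
    of \<open>\<Delta>\<close>.\<close>
  have "288 \<le> u * real T" using Tlow u by (simp add: field_simps)
  then have "\<Delta>'\<^sup>2 \<le> 72 * \<Delta>\<^sup>2 / 288"
    unfolding sq by (intro divide_left_mono) auto
  also have "\<dots> = (\<Delta> / 2)\<^sup>2" by (simp add: power2_eq_square)
  finally show half: "\<Delta>' \<le> \<Delta> / 2"
    by (rule power2_le_imp_le) (use \<Delta>0 in simp)
  define u' where "u' = \<alpha> * \<Delta>' / G\<^sup>2"
  have u': "u' \<ge> 0" using pos \<Delta>'pos by (simp add: u'_def)
  have u'half: "u' \<le> u / 2"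
  proof -
    have "u' = (\<alpha> / G\<^sup>2) * \<Delta>'" by (simp add: u'_def)
    also have "\<dots> \<le> (\<alpha> / G\<^sup>2) * (\<Delta> / 2)" using half pos by (intro mult_left_mono) auto
    finally show ?thesis by (simp add: u_def)
  qed
  define p where "p d = (if d > \<epsilon> then G\<^sup>2 / \<alpha> * (1 / \<epsilon> - 1 / (2 * d)) else 0)" for d
  have drop: "p \<Delta>' \<le> p \<Delta> - G\<^sup>2 / \<alpha> * (1 / (2 * \<Delta>))"
  proof (cases "\<Delta>' > \<epsilon>")
    case True
    have "1 / \<Delta> \<le> 1 / (2 * \<Delta>')" using half \<Delta>'pos by (intro divide_left_mono) (use \<Delta>0 in auto)
    then have "G\<^sup>2 / \<alpha> * (1 / \<epsilon> - 1 / (2 * \<Delta>')) \<le> G\<^sup>2 / \<alpha> * (1 / \<epsilon> - 1 / (2 * \<Delta>) - 1 / (2 * \<Delta>))"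
      using pos by (intro mult_left_mono) auto
    moreover have "p \<Delta>' = G\<^sup>2 / \<alpha> * (1 / \<epsilon> - 1 / (2 * \<Delta>'))" "p \<Delta> = G\<^sup>2 / \<alpha> * (1 / \<epsilon> - 1 / (2 * \<Delta>))"
      using True \<Delta> by (simp_all add: p_def)
    ultimately show ?thesis unfolding right_diff_distrib by argo
  next
    case False
    \<comment> \<open>The last pass: the summand falls to 0, and
      \<open>\<Delta> > \<epsilon>\<close> ensures that it was large enough to cover the claimed
      drop.\<close>
    have "1 / \<Delta> \<le> 1 / \<epsilon>" using \<Delta> pos by (intro divide_left_mono) auto
    then have "0 \<le> G\<^sup>2 / \<alpha> * (1 / \<epsilon> - 1 / (2 * \<Delta>) - 1 / (2 * \<Delta>))"
      using pos by (intro mult_nonneg_nonneg) auto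
    moreover have "p \<Delta>' = 0" "p \<Delta> = G\<^sup>2 / \<alpha> * (1 / \<epsilon> - 1 / (2 * \<Delta>))"
      using False \<Delta> by (simp_all add: p_def)
    ultimately show ?thesis unfolding right_diff_distrib by argo
  qed
  have loss: "G\<^sup>2 / \<alpha> * (1 / (2 * \<Delta>)) = 1 / (2 * u)" using pos by (simp add: u_def)
  have u_inv: "0 \<le> 1 / (2 * u)" using u by simp
  have pot: "call_potential \<alpha> \<epsilon> G \<Delta> = 1152 * (ln (1 + ln (1 + u)) + p \<Delta>)"
    "call_potential \<alpha> \<epsilon> G \<Delta>' = 1152 * (ln (1 + ln (1 + u')) + p \<Delta>')"
    by (simp_all add: call_potential_def prox_call_const_def p_def u_def u'_def)
  show "real T + call_potential \<alpha> \<epsilon> G \<Delta>' \<le> call_potential \<alpha> \<epsilon> G \<Delta>"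
  proof (cases "u \<ge> 288")
    case True
    have "\<lceil>288 / u\<rceil> = 1" using True u by (simp add: ceiling_eq_iff)
    then have T1: "real T = 1" by (simp add: T_def')
    have "u'\<^sup>2 = (u / \<Delta>)\<^sup>2 * \<Delta>'\<^sup>2" using \<Delta>0 by (simp add: u'_def u_def power_mult_distrib power_divide)
    also have "\<dots> = 72 * u" unfolding sq T1 using \<Delta>0 u by (simp add: power2_eq_square)
    finally have "u'\<^sup>2 = 72 * u" .
    from loglog_drop[OF True u' u'half this] show ?thesis
      using drop u_inv unfolding pot T1 loss by argo
  next
    case False
    have "real T \<le> 288 / u + 1" unfolding T_def' using u by simp
    \<comment> \<open>The 1 from rounding up is at most \<open>288 / u\<close> in this
      regime.\<close>
    also have "\<dots> \<le> 1152 * (1 / (2 * u))" using False u by (simp add: field_simps)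
    finally have "real T \<le> 1152 * (1 / (2 * u))" .
    moreover have "ln (1 + ln (1 + u')) \<le> ln (1 + ln (1 + u))"
      using u' u'half u by (intro loglog_mono) auto
    ultimately show ?thesis using drop unfolding pot loss by argo
  qed
qed

lemma call_potential_nonneg:
  assumes "\<alpha> > 0" "\<epsilon> > 0" "\<Delta> \<ge> 0"
  shows "call_potential \<alpha> \<epsilon> G \<Delta> \<ge> 0"
proof -
  have "1 / (2 * \<Delta>) \<le> 1 / \<epsilon>" if "\<Delta> > \<epsilon>"
    using that assms by (intro divide_left_mono) auto
  then show ?thesis
    using assms by (auto simp: call_potential_def prox_call_const_def intro!: mult_nonneg_nonneg add_nonneg_nonneg)
qed

lemma call_potential_le:
  assumes "\<alpha> > 0" "\<epsilon> > 0" "\<Delta> \<ge> 0"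
  shows "call_potential \<alpha> \<epsilon> G \<Delta> \<le>
    prox_call_const * (1 + G\<^sup>2 / (\<alpha> * \<epsilon>) + ln (1 + ln (1 + \<alpha> * \<Delta> / G\<^sup>2)))"
proof -
  have "G\<^sup>2 / \<alpha> * (1 / \<epsilon> - 1 / (2 * \<Delta>)) \<le> G\<^sup>2 / \<alpha> * (1 / \<epsilon>)"
    using assms by (intro mult_left_mono) auto
  moreover have "0 \<le> G\<^sup>2 / (\<alpha> * \<epsilon>)" using assms by simp
  ultimately show ?thesis
    unfolding call_potential_def prox_call_const_def by (intro mult_left_mono) auto
qed

section \<open>Real values on the domain, and the set of minimizers\<close>

lemma effective_domain_ereal:
  assumes "proper_fun R" "x \<in> effective_domain R"
  shows "ereal (real_of_ereal (R x)) = R x"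
  using assms by (cases "R x") (auto simp: proper_fun_def effective_domain_def)

text \<open>Convex combinations of graph points stay in the epigraph, which yields finiteness at the
  combined point together with the inequality.\<close>

lemma convex_on_effective_domain:
  assumes proper: "proper_fun R" and conv: "convex_fun R"
  shows "convex_on (effective_domain R) (\<lambda>x. real_of_ereal (R x))"
proof -
  have *: "R (u *\<^sub>R x + v *\<^sub>R y) \<le> ereal (u * real_of_ereal (R x) + v * real_of_ereal (R y))"
    if "x \<in> effective_domain R" "y \<in> effective_domain R" "0 \<le> u" "0 \<le> v" "u + v = 1" for x y u v
  proof -
    have "(x, real_of_ereal (R x)) \<in> ereal_epigraph R" "(y, real_of_ereal (R y)) \<in> ereal_epigraph R"
      using that proper by (simp_all add: ereal_epigraph_def effective_domain_ereal)
    then have "u *\<^sub>R (x, real_of_ereal (R x)) + v *\<^sub>R (y, real_of_ereal (R y)) \<in> ereal_epigraph R"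
      using conv that unfolding convex_fun_def by (intro convexD) auto
    then show ?thesis by (simp add: ereal_epigraph_def)
  qed
  then have dom: "u *\<^sub>R x + v *\<^sub>R y \<in> effective_domain R"
    if "x \<in> effective_domain R" "y \<in> effective_domain R" "0 \<le> u" "0 \<le> v" "u + v = 1" for x y u v
    using that unfolding effective_domain_def mem_Collect_eq by (meson ereal_less(2) less_ereal.simps order_le_less_trans)
  show ?thesis
    unfolding convex_on_def
  proof (intro conjI ballI allI impI)
    show "convex (effective_domain R)" using dom by (auto simp: convex_def)
  next
    fix x y and u v :: real
    assume "x \<in> effective_domain R" "y \<in> effective_domain R" "0 \<le> u" "0 \<le> v" "u + v = 1"
    from *[OF this] dom[OF this]
    show "real_of_ereal (R (u *\<^sub>R x + v *\<^sub>R y)) \<le> u * real_of_ereal (R x) + v * real_of_ereal (R y)"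
      using effective_domain_ereal[OF proper] by (metis ereal_less_eq(3))
  qed
qed

lemma minimizerD:
  assumes proper: "proper_fun R" and z: "z \<in> minimizers f R"
  shows "z \<in> effective_domain R"
    and "optimal_value f R = ereal (f z + real_of_ereal (R z))"
proof -
  have min: "objective f R z \<le> objective f R x" for x
    using z by (auto simp: minimizers_def is_arg_min_def not_less)
  obtain x where "x \<in> effective_domain R" using proper by (auto simp: proper_fun_def)
  then have "objective f R z < \<infinity>"
    using min[of x] by (auto simp: objective_def effective_domain_def)
  then show dom: "z \<in> effective_domain R"
    by (auto simp: objective_def effective_domain_def)
  have "optimal_value f R = objective f R z"
    unfolding optimal_value_def using min by (intro antisym INF_lower INF_greatest) auto
  then show "optimal_value f R = ereal (f z + real_of_ereal (R z))"
    using effective_domain_ereal[OF proper dom] by (simp add: objective_def flip: plus_ereal.simps(1))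
qed

lemma objective_gap:
  assumes "proper_fun R" "z \<in> minimizers f R" "x \<in> effective_domain R"
  shows "objective f R x - optimal_value f R =
    ereal (f x + real_of_ereal (R x) - (f z + real_of_ereal (R z)))"
  using minimizerD(2)[OF assms(1,2)] effective_domain_ereal[OF assms(1,3)]
  by (metis ereal_minus(1) objective_def plus_ereal.simps(1))

text \<open>The minimizers are the preimage of the closed epigraph under the continuous map from
  \<open>x\<close> to \<open>(x, c - f x)\<close>, where \<open>c\<close> is the minimal value.
  Closedness makes the distance to them attained.\<close>

lemma closed_minimizers:
  assumes proper: "proper_fun R" and closed: "closed_fun R" and f: "continuous_on UNIV f"
  shows "closed (minimizers f R)"
proof (cases "minimizers f R = {}")
  case False
  then obtain z where z: "z \<in> minimizers f R" by blast
  define c where "c = f z + real_of_ereal (R z)"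
  have z': "z \<in> effective_domain R" by (rule minimizerD(1)[OF proper z])
  have "objective f R z = ereal c"
    using effective_domain_ereal[OF proper z'] by (metis c_def objective_def plus_ereal.simps(1))
  moreover have "objective f R z \<le> objective f R x" for x
    using z by (auto simp: minimizers_def is_arg_min_def not_less)
  ultimately have "x \<in> minimizers f R \<longleftrightarrow> objective f R x \<le> ereal c" for x
    unfolding minimizers_def is_arg_min_def mem_Collect_eq not_ex not_less simp_thms by (metis order_trans)
  then have "x \<in> minimizers f R \<longleftrightarrow> (x, c - f x) \<in> ereal_epigraph R" for x
    by (cases "R x") (auto simp: objective_def ereal_epigraph_def)
  then have "minimizers f R = (\<lambda>x. (x, c - f x)) -` ereal_epigraph R" by auto
  moreover have "continuous_on UNIV (\<lambda>x. (x, c - f x))"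
    by (intro continuous_intros f)
  ultimately show ?thesis
    using closed unfolding closed_fun_def by (simp only: closed_vimage)
qed simp

text \<open>Quadratic growth, applied at a nearest minimizer, turns the gap into a distance; this
  explains the radius \<open>D\<close> of a stage.\<close>

lemma minimizer_within_growth_radius:
  fixes f :: "'a::heine_borel \<Rightarrow> real"
  assumes "proper_fun R" "closed_fun R" "continuous_on UNIV f" and ne: "minimizers f R \<noteq> {}"
    and \<alpha>: "\<alpha> > 0" and growth: "quadratic_growth f R \<alpha>" and c: "c \<in> effective_domain R"
    and gap: "objective f R c - optimal_value f R \<le> ereal \<Delta>"
  obtains z where "z \<in> minimizers f R" "dist c z \<le> sqrt (2 * \<Delta> / \<alpha>)"
proof -
  obtain z where z: "z \<in> minimizers f R" "infdist c (minimizers f R) = dist c z"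
    using infdist_attains_inf[OF closed_minimizers ne] assms(1-3) by blast
  have "ereal (\<alpha> / 2 * (dist c z)\<^sup>2) \<le> ereal \<Delta>"
    using growth c gap unfolding quadratic_growth_def z(2)[symmetric] by (metis order_trans)
  then have "(dist c z)\<^sup>2 \<le> 2 * \<Delta> / \<alpha>" using \<alpha> by (simp add: field_simps)
  then show ?thesis using that z(1) by (simp add: real_le_rsqrt)
qed

section \<open>One pass of the restart loop\<close>

text \<open>Since \<open>b\<close> is at least 1, it is less than twice its floor. This serves the
  termination measure.\<close>

lemma floor_less_if_le_half:
  fixes a b :: real
  assumes "1 \<le> b" "a \<le> b / 2"
  shows "\<lfloor>a\<rfloor> < \<lfloor>b\<rfloor>"
proof -
  have "1 \<le> \<lfloor>b\<rfloor>" using assms(1) by simp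
  then have "b / 2 < of_int \<lfloor>b\<rfloor>" using floor_correct[of b] by linarith
  then show ?thesis using assms(2) by (simp add: floor_less_iff)
qed

text \<open>The centre lies in the initial sublevel set and the radius is at most the initial one,
  so the ball lies in the enlarged set, where \<open>Gbar\<close> bounds subgradients. The level
  \<open>E\<close> is the current \<open>\<Delta>\<close>. The factor 6 in place of 5 leaves slack
  beyond the stage bound.\<close>

lemma algorithm_A_halves_gap:
  fixes f :: "'a::euclidean_space \<Rightarrow> real" and R :: "'a \<Rightarrow> ereal"
  defines "r \<equiv> \<lambda>x. real_of_ereal (R x)"
  assumes f: "convex_on UNIV f" and R: "proper_fun R" "closed_fun R" "convex_fun R"
    and z: "z \<in> minimizers f R" and \<alpha>: "\<alpha> > 0" and growth: "quadratic_growth f R \<alpha>"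
    and prox: "weak_proximal_oracle f R A"
    and subgrad: "\<And>m y. g m y \<in> subdifferential f y"
    and G: "G > 0" "G \<le> Gbar"
    and level: "\<And>x h. x \<in> sublevel f R \<Delta>\<^sub>0 \<Longrightarrow> h \<in> subdifferential f x \<Longrightarrow> norm h \<le> G"
    and enlarged: "\<And>x h. x \<in> enlarged_sublevel f R \<alpha> \<Delta>\<^sub>0 \<Longrightarrow> h \<in> subdifferential f x \<Longrightarrow> norm h \<le> Gbar"
    and K: "K > 0" "Gbar\<^sup>2 \<le> G\<^sup>2 * real K" and T: "T > 0"
    and \<Delta>: "0 < \<Delta>" "\<Delta> \<le> \<Delta>\<^sub>0" and shrink: "6 * G * sqrt (2 * \<Delta> / (\<alpha> * real T)) \<le> \<Delta> / 2"
    and c: "c \<in> effective_domain R" and gap: "f c + r c \<le> f z + r z + \<Delta>"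
  obtains v where "algorithm_A g A c (sqrt (2 * \<Delta> / \<alpha>)) G Gbar T K n m = (v, n + T, m + T * K)"
    "v \<in> effective_domain R" "f v + r v \<le> f z + r z + 6 * G * sqrt (2 * \<Delta> / (\<alpha> * real T))"
proof -
  define S where "S = effective_domain R"
  define D where "D = sqrt (2 * \<Delta> / \<alpha>)"
  have D: "D > 0" using \<Delta> \<alpha> by (simp add: D_def)
  have gap_iff: "objective f R u - optimal_value f R \<le> ereal d \<longleftrightarrow> f u + r u \<le> f z + r z + d"
    if "u \<in> S" for u d
    using objective_gap[OF R(1) z, of u] that unfolding S_def r_def by auto
  have r: "ereal (r u) = R u" if "u \<in> S" for u
    using effective_domain_ereal[OF R(1)] that by (simp add: r_def S_def)
  obtain x where x: "x \<in> minimizers f R" and "dist c x \<le> D"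
    using minimizer_within_growth_radius[OF R(1,2) convex_on_continuous[OF open_UNIV f] _ \<alpha> growth c]
      gap gap_iff[of c \<Delta>] c z unfolding D_def S_def by blast
  then have near: "norm (x - c) \<le> D" by (simp add: dist_norm norm_minus_commute)
  have xS: "x \<in> S" unfolding S_def by (rule minimizerD(1)[OF R(1) x])
  \<comment> \<open>The reference \<open>z\<close> is fixed for the whole run, whereas
    \<open>x\<close> depends on the centre; both attain the minimum.\<close>
  have xz: "f x + r x = f z + r z"
    using minimizerD(2)[OF R(1) x] minimizerD(2)[OF R(1) z] by (simp add: r_def)
  have cl: "c \<in> sublevel f R \<Delta>\<^sub>0"
    using gap_iff[of c "\<Delta>\<^sub>0"] c gap \<Delta> by (simp add: sublevel_def S_def)
  have scale: "6 * G * sqrt (2 * \<Delta> / (\<alpha> * real T)) = 6 * (G * D / sqrt (real T))"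
    by (simp add: D_def real_sqrt_divide real_sqrt_mult)
  have e: "G * D / sqrt (real T) > 0" using G D T by simp
  have prox_in: "A y l \<in> S" if "l > 0" for y l
    using prox that by (simp add: weak_proximal_oracle_def S_def)
  obtain v where v: "algorithm_A g A c D G Gbar T K n m = (v, n + T, m + T * K)" "v \<in> S"
    "f v + r v \<le> f x + r x + 5 * (G * D / sqrt (real T))"
  proof (rule algorithm_A_bound[where f = f and r = r and S = S and g = g and A = A and x = x
        and c = c and D = D and E = \<Delta> and T = T and K = K and G = G and Gbar = Gbar and n = n and m = m])
    show "convex_on S r" unfolding S_def r_def by (rule convex_on_effective_domain[OF R(1,3)])
    show "l * (norm (A y l - y))\<^sup>2 + r (A y l) \<le> l * (norm (x - y))\<^sup>2 + r x" if "l > 0" for y l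
    proof -
      have "ereal (l * (norm (A y l - y))\<^sup>2) + R (A y l) \<le> ereal (l * (norm (x - y))\<^sup>2) + R x"
        using prox x that by (simp add: weak_proximal_oracle_def)
      then show ?thesis using r[OF xS] r[OF prox_in[OF that]]
        by (metis ereal_less_eq(3) plus_ereal.simps(1))
    qed
    show "norm h \<le> Gbar" if y: "y \<in> cball c D" and h: "h \<in> subdifferential f y" for y h
    proof (rule enlarged[OF _ h])
      have "infdist y (sublevel f R \<Delta>\<^sub>0) \<le> dist y c" by (rule infdist_le[OF cl])
      also have "\<dots> \<le> D" using y by (simp add: dist_commute)
      also have "\<dots> \<le> sqrt (2 * \<Delta>\<^sub>0 / \<alpha>)"
        unfolding D_def using \<Delta> \<alpha> by (simp add: divide_right_mono)
      finally show "y \<in> enlarged_sublevel f R \<alpha> \<Delta>\<^sub>0" by (simp add: enlarged_sublevel_def)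
    qed
    show "norm h \<le> G" if "w \<in> S" "f w + r w \<le> f x + r x + \<Delta>" "h \<in> subdifferential f w" for w h
      using level[OF _ that(3)] gap_iff[OF that(1), of \<Delta>\<^sub>0] that(1,2) \<Delta> xz
      by (simp add: sublevel_def S_def)
    show "5 * (G * D / sqrt (real T)) < \<Delta>" using shrink \<Delta> e unfolding scale by linarith
  qed (use f subgrad prox_in xS near D T K G that in auto)
  then have "f v + r v \<le> f z + r z + 6 * G * sqrt (2 * \<Delta> / (\<alpha> * real T))"
    using e xz unfolding scale by argo
  with v(1,2) show ?thesis using that unfolding D_def S_def by blast
qed

section \<open>Algorithm B: termination, accuracy and call counts\<close>

theorem theorem8:
  fixes f :: "'a::euclidean_space \<Rightarrow> real"
    and R :: "'a \<Rightarrow> ereal"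
    and A :: "'a \<Rightarrow> real \<Rightarrow> 'a"
    and g :: "nat \<Rightarrow> 'a \<Rightarrow> 'a"
    and x_in :: 'a
    and \<alpha> \<epsilon> \<Delta>\<^sub>0 G Gbar :: real
  assumes "convex_on UNIV f" and "closed (epigraph UNIV f)"
    and "proper_fun R" and "closed_fun R" and "convex_fun R"
    and "minimizers f R \<noteq> {}"
    and "\<alpha> > 0" and "quadratic_growth f R \<alpha>"
    and "weak_proximal_oracle f R A"
    and "\<And>m y. g m y \<in> subdifferential f y"
    and "x_in \<in> effective_domain R"
    and "objective f R x_in - optimal_value f R \<le> ereal \<Delta>\<^sub>0"
    and "G > 0"
    and "\<And>x h. x \<in> sublevel f R \<Delta>\<^sub>0 \<Longrightarrow> h \<in> subdifferential f x \<Longrightarrow> norm h \<le> G"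
    and "bdd_above {norm h | u h. u \<in> enlarged_sublevel f R \<alpha> \<Delta>\<^sub>0 \<and> h \<in> subdifferential f u}"
    and "Gbar = max G
      (Sup {norm h | u h. u \<in> enlarged_sublevel f R \<alpha> \<Delta>\<^sub>0 \<and> h \<in> subdifferential f u})"
    and "\<epsilon> > 0"
  shows "\<exists>xhat \<Delta> n m.
    algorithm_B g A x_in \<Delta>\<^sub>0 \<alpha> \<epsilon> G Gbar = Some (xhat, \<Delta>, n, m) \<and>
    xhat \<in> effective_domain R \<and>
    objective f R xhat - optimal_value f R \<le> ereal \<epsilon> \<and>
    real n \<le> prox_call_const *
      (1 + G\<^sup>2 / (\<alpha> * \<epsilon>) + ln (1 + ln (1 + \<alpha> * \<Delta>\<^sub>0 / G\<^sup>2))) \<and>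
    real m \<le> subgrad_call_const *
      (Gbar\<^sup>2 / (\<alpha> * \<epsilon>) + Gbar\<^sup>2 / G\<^sup>2 * (1 + ln (1 + ln (1 + \<alpha> * \<Delta>\<^sub>0 / G\<^sup>2))))"
proof -
  note proper = assms(3) and \<alpha> = \<open>\<alpha> > 0\<close> and G = \<open>G > 0\<close> and \<epsilon> = \<open>\<epsilon> > 0\<close>
  obtain z where z: "z \<in> minimizers f R" using assms(6) by blast
  define F where "F u = f u + real_of_ereal (R u)" for u
  define S where "S = effective_domain R"
  have gap: "objective f R u - optimal_value f R = ereal (F u - F z)" if "u \<in> S" for u
    using objective_gap[OF proper z] that unfolding S_def F_def by blast
  have Fz: "F z \<le> F u" if "u \<in> S" for u
  proof -
    have "optimal_value f R \<le> objective f R u" unfolding optimal_value_def by (rule INF_lower) simp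
    then have "0 \<le> objective f R u - optimal_value f R"
      using minimizerD(2)[OF proper z] by (simp add: ereal_diff_positive)
    then show ?thesis unfolding gap[OF that] by simp
  qed
  have x_in: "x_in \<in> S" "F x_in \<le> F z + \<Delta>\<^sub>0"
    using assms(11,12) gap[of x_in] by (auto simp: S_def)
  then have \<Delta>0: "\<Delta>\<^sub>0 \<ge> 0" using Fz[of x_in] by linarith
  have GG: "G \<le> Gbar" using assms(16) by simp
  have enlarged: "norm h \<le> Gbar"
    if "u \<in> enlarged_sublevel f R \<alpha> \<Delta>\<^sub>0" "h \<in> subdifferential f u" for u h
  proof -
    have "norm h \<le> Sup {norm h | u h. u \<in> enlarged_sublevel f R \<alpha> \<Delta>\<^sub>0 \<and> h \<in> subdifferential f u}"
      by (rule cSup_upper[OF _ assms(15)]) (use that in blast)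
    then show ?thesis using assms(16) by simp
  qed
  define \<gamma> where "\<gamma> = Gbar\<^sup>2 / G\<^sup>2"
  have \<gamma>: "\<gamma> \<ge> 1" using G GG by (simp add: \<gamma>_def power_mono)
  define K where "K = nat \<lceil>\<gamma>\<rceil>"
  \<comment> \<open>Rounding up adds less than 1, which is at most \<open>\<gamma>\<close>; this is
    the factor 2 between the two call constants.\<close>
  have K: "K > 0" "\<gamma> \<le> real K" "real K \<le> 2 * \<gamma>"
    using \<gamma> unfolding K_def by linarith+
  have K': "Gbar\<^sup>2 \<le> G\<^sup>2 * real K" using K(2) G by (simp add: \<gamma>_def field_simps)
  let ?loop = "\<lambda>(x, \<Delta>, n, m). \<Delta> > \<epsilon>"
  let ?step = "\<lambda>(x, \<Delta>, n, m).
    let D = sqrt (2 * \<Delta> / \<alpha>);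
        T = nat \<lceil>288 * G\<^sup>2 / (\<alpha> * \<Delta>)\<rceil>;
        (x', n', m') = algorithm_A g A x D G Gbar T K n m
    in (x', 6 * G * sqrt (2 * \<Delta> / (\<alpha> * real T)), n', m')"
  \<comment> \<open>The loop invariant. \<open>\<Delta> \<le> \<Delta>\<^sub>0\<close> keeps the
    subgradient bounds applicable, \<open>m = n * K\<close> reduces the second count to the first,
    and the last clause pays for the calls made so far out of the initial potential.\<close>
  define P where "P = (\<lambda>(x, \<Delta>, n, m). x \<in> S \<and> F x \<le> F z + \<Delta> \<and> \<Delta> \<le> \<Delta>\<^sub>0 \<and> m = n * K \<and>
    real n + call_potential \<alpha> \<epsilon> G \<Delta> \<le> call_potential \<alpha> \<epsilon> G \<Delta>\<^sub>0)"
  define \<mu> where "\<mu> = (\<lambda>(x::'a, \<Delta>, n::nat, m::nat). nat \<lfloor>\<Delta> / \<epsilon>\<rfloor>)"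
  have step: "P (?step s) \<and> \<mu> (?step s) < \<mu> s" if "P s" "?loop s" for s
  proof -
    obtain x \<Delta> n m where s: "s = (x, \<Delta>, n, m)" by (cases s)
    have inv: "x \<in> S" "F x \<le> F z + \<Delta>" "\<Delta> \<le> \<Delta>\<^sub>0" "m = n * K" "\<epsilon> < \<Delta>"
      "real n + call_potential \<alpha> \<epsilon> G \<Delta> \<le> call_potential \<alpha> \<epsilon> G \<Delta>\<^sub>0"
      using that by (auto simp: s P_def)
    define T where "T = nat \<lceil>288 * G\<^sup>2 / (\<alpha> * \<Delta>)\<rceil>"
    define \<Delta>' where "\<Delta>' = 6 * G * sqrt (2 * \<Delta> / (\<alpha> * real T))"
    note decr = call_potential_decrease[OF \<alpha> \<epsilon> G inv(5), folded T_def, folded \<Delta>'_def]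
    have \<Delta>: "0 < \<Delta>" using inv(5) \<epsilon> by linarith
    obtain v where v: "algorithm_A g A x (sqrt (2 * \<Delta> / \<alpha>)) G Gbar T K n m = (v, n + T, m + T * K)"
      "v \<in> S" "F v \<le> F z + \<Delta>'"
    proof (rule algorithm_A_halves_gap[where g = g and n = n and m = m and T = T and \<Delta> = \<Delta> and c = x
          and G = G and Gbar = Gbar and K = K and \<Delta>\<^sub>0 = \<Delta>\<^sub>0,
          OF assms(1,3-5) z \<alpha> assms(8,9)])
      show "6 * G * sqrt (2 * \<Delta> / (\<alpha> * real T)) \<le> \<Delta> / 2"
        using decr(3) unfolding \<Delta>'_def .
      show "f x + real_of_ereal (R x) \<le> f z + real_of_ereal (R z) + \<Delta>"
        using inv(2) unfolding F_def .
      fix v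
      assume v: "algorithm_A g A x (sqrt (2 * \<Delta> / \<alpha>)) G Gbar T K n m = (v, n + T, m + T * K)"
        "v \<in> effective_domain R"
        "f v + real_of_ereal (R v) \<le> f z + real_of_ereal (R z) + 6 * G * sqrt (2 * \<Delta> / (\<alpha> * real T))"
      show thesis
        by (rule that[OF v(1)]) (use v(2,3) in \<open>simp_all add: S_def F_def \<Delta>'_def\<close>)
    qed (use assms(10,14) G GG enlarged K(1) K' decr(1) inv(1,3) \<Delta> in \<open>simp_all add: S_def\<close>)
    have s': "?step s = (v, \<Delta>', n + T, m + T * K)"
      using v(1) by (simp add: s Let_def flip: T_def \<Delta>'_def)
    have "P (?step s)"
      unfolding s' P_def using v decr inv \<Delta> by (auto simp: algebra_simps)
    moreover have "\<lfloor>\<Delta>' / \<epsilon>\<rfloor> < \<lfloor>\<Delta> / \<epsilon>\<rfloor>" "1 \<le> \<lfloor>\<Delta> / \<epsilon>\<rfloor>"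
    proof -
      have "\<Delta>' / \<epsilon> \<le> (\<Delta> / \<epsilon>) / 2" using decr(3) \<epsilon> by (simp add: field_simps)
      moreover have "1 \<le> \<Delta> / \<epsilon>" using inv(5) \<epsilon> by simp
      ultimately show "\<lfloor>\<Delta>' / \<epsilon>\<rfloor> < \<lfloor>\<Delta> / \<epsilon>\<rfloor>" "1 \<le> \<lfloor>\<Delta> / \<epsilon>\<rfloor>"
        by (simp_all only: floor_less_if_le_half one_le_floor)
    qed
    then have "\<mu> (?step s) < \<mu> s" unfolding s' by (simp add: \<mu>_def s)
    ultimately show ?thesis by blast
  qed
  have init: "P (x_in, \<Delta>\<^sub>0, 0, 0)" using x_in by (simp add: P_def)
  have B: "algorithm_B g A x_in \<Delta>\<^sub>0 \<alpha> \<epsilon> G Gbar = while_option ?loop ?step (x_in, \<Delta>\<^sub>0, 0, 0)"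
    by (simp add: algorithm_B_def Let_def K_def \<gamma>_def)
  obtain s where s: "while_option ?loop ?step (x_in, \<Delta>\<^sub>0, 0, 0) = Some s"
    using measure_while_option_Some[of P ?loop ?step \<mu>, OF step init] by blast
  obtain xhat \<Delta> n m where s': "s = (xhat, \<Delta>, n, m)" by (cases s)
  have "P s" by (rule while_option_rule[where P = P, OF _ s init]) (use step in blast)
  then have inv: "xhat \<in> S" "F xhat \<le> F z + \<Delta>" "m = n * K"
    "real n + call_potential \<alpha> \<epsilon> G \<Delta> \<le> call_potential \<alpha> \<epsilon> G \<Delta>\<^sub>0"
    by (auto simp: s' P_def)
  have \<Delta>: "\<Delta> \<le> \<epsilon>" using while_option_stop[OF s] by (simp add: s')
  \<comment> \<open>Derived from the gap at exit, this also covers a loop that is never entered,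
    where \<open>\<Delta>\<^sub>0\<close> may be 0. It makes the remaining potential
    nonnegative.\<close>
  have \<Delta>pos: "0 \<le> \<Delta>" using Fz[OF inv(1)] inv(2) by linarith
  define X where "X = 1 + G\<^sup>2 / (\<alpha> * \<epsilon>) + ln (1 + ln (1 + \<alpha> * \<Delta>\<^sub>0 / G\<^sup>2))"
  have n: "real n \<le> prox_call_const * X"
    using inv(4) call_potential_nonneg[OF \<alpha> \<epsilon> \<Delta>pos, of G] call_potential_le[OF \<alpha> \<epsilon> \<Delta>0, of G]
    unfolding X_def by linarith
  have "real m \<le> (prox_call_const * X) * (2 * \<gamma>)"
    unfolding inv(3) of_nat_mult using n K(3) by (intro mult_mono) auto
  also have "\<dots> = subgrad_call_const *
      (Gbar\<^sup>2 / (\<alpha> * \<epsilon>) + Gbar\<^sup>2 / G\<^sup>2 * (1 + ln (1 + ln (1 + \<alpha> * \<Delta>\<^sub>0 / G\<^sup>2))))"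
  proof -
    have "\<gamma> * (G\<^sup>2 / (\<alpha> * \<epsilon>)) = Gbar\<^sup>2 / (\<alpha> * \<epsilon>)" using G by (simp add: \<gamma>_def)
    then show ?thesis
      unfolding \<gamma>_def[symmetric] X_def prox_call_const_def subgrad_call_const_def
      by (simp add: distrib_left distrib_right mult.commute)
  qed
  finally have m: "real m \<le> subgrad_call_const *
      (Gbar\<^sup>2 / (\<alpha> * \<epsilon>) + Gbar\<^sup>2 / G\<^sup>2 * (1 + ln (1 + ln (1 + \<alpha> * \<Delta>\<^sub>0 / G\<^sup>2))))" .
  have "objective f R xhat - optimal_value f R \<le> ereal \<epsilon>"
    unfolding gap[OF inv(1)] using inv(2) \<Delta> by simp
  moreover have "algorithm_B g A x_in \<Delta>\<^sub>0 \<alpha> \<epsilon> G Gbar = Some (xhat, \<Delta>, n, m)"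
    using B s s' by simp
  ultimately show ?thesis
    using inv(1) n m unfolding X_def S_def by blast
qed

end
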